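(* Let $C_k$, $k\in\mathbb{N}$, be successive subdivisions of $M$ such that the maximum diameter $d_k$ of the cells of $C_k$ tends to $0$, and let $G_k$ be the symbolic image of $f$ for $C_k$. Let $m^k$ be a consistent sequence of simple flows on the symbolic images $G_k$, and for each $k$ let $\mu_k$ be the measure on $M$ defined by $$\mu_k(A)=\sum_i m_i^k\,\frac{v(A\cap M_k(i))}{v(M_k(i))},$$ where the $M_k(i)$ are the cells of $C_k$. Then there exists an $f$-invariant measure $$\mu=\lim_{k\to\infty}\mu_k$$ (limit in the weak topology), and $\mu$ is an ergodic measure.
   Context: $M$ is a compact Riemannian manifold, $f\colon M\to M$ is a homeomorphism, and $v$ is the Lebesgue measure (Riemannian volume) on $M$. A covering $C$ is a finite covering of $M$ by closed polyhedral cells $M(i)$ (as in a triangulation of $M$), distinct cells intersecting in boundary discs, with $v(M(i))\neq 0$. The symbolic image of $f$ for $C$ is the directed graph $G$ whose vertices $i$ correspond to the cells, with an arc $i\to j$ if and only if $f(M(i))\cap M(j)\neq\varnothing$. $C_{k+1}$ is a subdivision of $C_k$: each cell $M_k(i)$ of $C_k$ is a finite union of cells $m(i,l)$, $l=1,2,\dots$, and $C_{k+1}=\{m(i,l)\}$. The vertices of $G_{k+1}$ are the pairs $(i,l)$, and $s(i,l)=i$ defines a map of directed graphs $s\colon G_{k+1}\to G_k$ (arcs go to arcs). A flow on a directed graph $G$ is a distribution $m=\{m_{ij}\}$ on the arcs $i\to j$ with $m_{ij}\geqslant 0$, $\sum m_{ij}=1$, and $\sum_k m_{ki}=\sum_j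 m_{ij}$ for each vertex $i$; the measure of a vertex is $m_i=\sum_j m_{ij}$. A simple cycle is a cycle $\omega=\{i_1\to i_2\to\dots\to i_p\to i_1\}$ with all $i_1,\dots,i_p$ distinct; the simple flow generated by $\omega$ is $m_{ij}=1/p$ if $(i\to j)\in\omega$ and $m_{ij}=0$ otherwise. A map of directed graphs $s\colon Q\to G$ induces a map $s^*$ from flows on $Q$ to flows on $G$ by $(s^*m)_{ij}=\sum_{s(p\to q)=i\to j}m_{pq}$ (sum over arcs $p\to q$ of $Q$ mapped to $i\to j$; zero if there are none). A sequence of flows $m^k$ on $G_k$ is consistent if $s^*m^{k+1}=m^k$ for all $k$. Weak convergence $\mu_k\to\mu$ means $\int_M\varphi\,d\mu_k\to\int_M\varphi\,d\mu$ for every continuous $\varphi\colon M\to\mathbb{R}$. A normalized measure $\mu$ ($\mu(M)=1$) is $f$-invariant if $\mu(f^{-1}(A))=\mu(A)=\mu(f(A))$ for every measurable $A$; it is ergodic if moreover $\mu(A)=0$ or $\mu(M\setminus A)=0$ for every invariant measurable $A$. *)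

theory Defs
  imports "HOL-Probability.Probability" "Graph_Theory.Arc_Walk"
begin

section \<open>Compact Riemannian manifolds\<close>

text \<open>
  The manifold is a whole type \<open>'a\<close>. Its dimension is \<open>CARD('n)\<close>. A chart is a pair consisting of an
  open domain and a coordinate map.
\<close>

type_synonym ('a, 'n) chart = "'a set \<times> ('a \<Rightarrow> real ^ 'n)"

primrec ck_on :: "nat \<Rightarrow> ('e::euclidean_space \<Rightarrow> 'f::real_normed_vector) \<Rightarrow> 'e set \<Rightarrow> bool" where
  "ck_on 0 h S \<longleftrightarrow> continuous_on S h"
| "ck_on (Suc k) h S \<longleftrightarrow>
     (\<forall>x\<in>S. h differentiable (at x)) \<and> (\<forall>w. ck_on k (\<lambda>x. frechet_derivative h (at x) w) S)"

text \<open>Only used on open sets.\<close>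

definition smooth_on :: "('e::euclidean_space \<Rightarrow> 'f::real_normed_vector) \<Rightarrow> 'e set \<Rightarrow> bool" where
  "smooth_on h S \<longleftrightarrow> (\<forall>k. ck_on k h S)"

definition chart_inv :: "('a, 'n) chart \<Rightarrow> real ^ 'n \<Rightarrow> 'a" where
  "chart_inv c = inv_into (fst c) (snd c)"

definition smooth_atlas ::
    "('a::{t2_space,second_countable_topology}, 'n::finite) chart set \<Rightarrow> bool" where
  "smooth_atlas \<A> \<longleftrightarrow>
     (\<Union>c\<in>\<A>. fst c) = UNIV \<and>
     (\<forall>c\<in>\<A>. open (fst c) \<and> open (snd c ` fst c) \<and>
        homeomorphism (fst c) (snd c ` fst c) (snd c) (chart_inv c)) \<and>
     (\<forall>c\<in>\<A>. \<forall>d\<in>\<A>. smooth_on (snd d \<circ> chart_inv c) (snd c ` (fst c \<inter> fst d)))"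

text \<open>
  \<open>g c x\<close> is the matrix of the metric tensor at \<open>x\<close> in the coordinates of the chart \<open>c\<close>; the last
  clause is the transformation law of a covariant 2-tensor.
\<close>

definition riemannian_metric ::
    "('a::{t2_space,second_countable_topology}, 'n::finite) chart set \<Rightarrow>
     (('a, 'n) chart \<Rightarrow> 'a \<Rightarrow> real ^ 'n ^ 'n) \<Rightarrow> bool" where
  "riemannian_metric \<A> g \<longleftrightarrow>
     (\<forall>c\<in>\<A>. \<forall>x\<in>fst c. transpose (g c x) = g c x \<and> (\<forall>u. u \<noteq> 0 \<longrightarrow> 0 < u \<bullet> (g c x *v u))) \<and>
     (\<forall>c\<in>\<A>. smooth_on (\<lambda>y. g c (chart_inv c y)) (snd c ` fst c)) \<and>
     (\<forall>c\<in>\<A>. \<forall>d\<in>\<A>. \<forall>x\<in>fst c \<inter> fst d.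
        (let J = matrix (frechet_derivative (snd d \<circ> chart_inv c) (at (snd c x)))
         in g c x = transpose J ** g d x ** J))"

definition compact_riemannian_manifold ::
    "('a::{t2_space,second_countable_topology}, 'n::finite) chart set \<Rightarrow>
     (('a, 'n) chart \<Rightarrow> 'a \<Rightarrow> real ^ 'n ^ 'n) \<Rightarrow> bool" where
  "compact_riemannian_manifold \<A> g \<longleftrightarrow>
     compact (UNIV :: 'a set) \<and> smooth_atlas \<A> \<and> riemannian_metric \<A> g"

definition piecewise_C1_curve ::
    "('a::{t2_space,second_countable_topology}, 'n::finite) chart set \<Rightarrow> (real \<Rightarrow> 'a) \<Rightarrow> bool" where
  "piecewise_C1_curve \<A> \<gamma> \<longleftrightarrow>
     path \<gamma> \<and>
     (\<forall>c\<in>\<A>. \<forall>a b. 0 \<le> a \<and> a \<le> b \<and> b \<le> 1 \<and> \<gamma> ` {a..b} \<subseteq> fst c \<longrightarrow>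
        (snd c \<circ> \<gamma>) piecewise_C1_differentiable_on {a..b})"

text \<open>The speed is computed in an arbitrary chart around \<open>\<gamma> t\<close>; it does not depend on the choice.\<close>

definition speed ::
    "('a::{t2_space,second_countable_topology}, 'n::finite) chart set \<Rightarrow>
     (('a, 'n) chart \<Rightarrow> 'a \<Rightarrow> real ^ 'n ^ 'n) \<Rightarrow> (real \<Rightarrow> 'a) \<Rightarrow> real \<Rightarrow> real" where
  "speed \<A> g \<gamma> t =
     (let c = (SOME c. c \<in> \<A> \<and> \<gamma> t \<in> fst c);
          u = vector_derivative (snd c \<circ> \<gamma>) (at t)
      in sqrt (u \<bullet> (g c (\<gamma> t) *v u)))"

definition curve_length ::
    "('a::{t2_space,second_countable_topology}, 'n::finite) chart set \<Rightarrow>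
     (('a, 'n) chart \<Rightarrow> 'a \<Rightarrow> real ^ 'n ^ 'n) \<Rightarrow> (real \<Rightarrow> 'a) \<Rightarrow> ennreal" where
  "curve_length \<A> g \<gamma> = (\<integral>\<^sup>+t\<in>{0..1}. ennreal (speed \<A> g \<gamma> t) \<partial>lborel)"

text \<open>The distance is infinite between different components.\<close>

definition riemannian_dist ::
    "('a::{t2_space,second_countable_topology}, 'n::finite) chart set \<Rightarrow>
     (('a, 'n) chart \<Rightarrow> 'a \<Rightarrow> real ^ 'n ^ 'n) \<Rightarrow> 'a \<Rightarrow> 'a \<Rightarrow> ennreal" where
  "riemannian_dist \<A> g x y =
     (INF \<gamma>\<in>{\<gamma>. piecewise_C1_curve \<A> \<gamma> \<and> pathstart \<gamma> = x \<and> pathfinish \<gamma> = y}.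
        curve_length \<A> g \<gamma>)"

definition riemannian_diameter ::
    "('a::{t2_space,second_countable_topology}, 'n::finite) chart set \<Rightarrow>
     (('a, 'n) chart \<Rightarrow> 'a \<Rightarrow> real ^ 'n ^ 'n) \<Rightarrow> 'a set \<Rightarrow> ennreal" where
  "riemannian_diameter \<A> g S = (SUP x\<in>S. SUP y\<in>S. riemannian_dist \<A> g x y)"

text \<open>
  The Riemannian volume is the unique Borel measure that in each chart has density
  \<open>sqrt (det g)\<close> with respect to Lebesgue measure.
\<close>

definition riemannian_volume ::
    "('a::{t2_space,second_countable_topology}, 'n::finite) chart set \<Rightarrow>
     (('a, 'n) chart \<Rightarrow> 'a \<Rightarrow> real ^ 'n ^ 'n) \<Rightarrow> 'a measure \<Rightarrow> bool" where
  "riemannian_volume \<A> g v \<longleftrightarrow>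
     sets v = sets borel \<and>
     (\<forall>c\<in>\<A>. \<forall>B\<in>sets borel. B \<subseteq> fst c \<longrightarrow>
        emeasure v B =
          (\<integral>\<^sup>+y\<in>snd c ` B. ennreal (sqrt (det (g c (chart_inv c y)))) \<partial>lborel))"


section \<open>Coverings by polyhedral cells\<close>

text \<open>
  As in a topological triangulation, a cell is a homeomorphic image of a full-dimensional convex
  polytope. The argument of type \<open>'n itself\<close> carries the dimension.
\<close>

definition polyhedral_cell :: "'n::finite itself \<Rightarrow> 'a::topological_space set \<Rightarrow> bool" where
  "polyhedral_cell _ C \<longleftrightarrow>
     (\<exists>P :: (real ^ 'n) set. polytope P \<and> interior P \<noteq> {} \<and> C homeomorphic P)"

text \<open>A closed disc of some dimension less than \<open>CARD('n)\<close>, possibly a point.\<close>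

definition lower_disc :: "'n::finite itself \<Rightarrow> 'a::topological_space set \<Rightarrow> bool" where
  "lower_disc _ D \<longleftrightarrow>
     (\<exists>S :: (real ^ 'n) set. subspace S \<and> dim S < CARD('n) \<and> D homeomorphic (cball 0 1 \<inter> S))"

text \<open>
  The cells are \<open>M i\<close> for \<open>i \<in> I\<close>. Two distinct cells meet in a finite, possibly empty, union of
  discs lying in the boundaries of both.
\<close>

definition polyhedral_covering ::
    "'n::finite itself \<Rightarrow> 'a::topological_space measure \<Rightarrow> 'i set \<Rightarrow> ('i \<Rightarrow> 'a set) \<Rightarrow> bool" where
  "polyhedral_covering n v I M \<longleftrightarrow>
     finite I \<and> (\<Union>i\<in>I. M i) = UNIV \<and>
     (\<forall>i\<in>I. closed (M i) \<and> polyhedral_cell n (M i) \<and> emeasure v (M i) \<noteq> 0) \<and>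
     (\<forall>i\<in>I. \<forall>j\<in>I. i \<noteq> j \<longrightarrow>
        (\<exists>\<D>. finite \<D> \<and> M i \<inter> M j = \<Union>\<D> \<and>
           (\<forall>D\<in>\<D>. lower_disc n D \<and> D \<subseteq> frontier (M i) \<inter> frontier (M j))))"

text \<open>
  The cells \<open>m(i,l)\<close> into which \<open>M i\<close> is divided are the \<open>N j\<close> with \<open>s j = i\<close>: the map \<open>s\<close> sends the
  index of a cell of the finer covering to the index of the cell it is a part of.
\<close>

definition subdivision ::
    "'i set \<Rightarrow> ('i \<Rightarrow> 'a set) \<Rightarrow> 'i set \<Rightarrow> ('i \<Rightarrow> 'a set) \<Rightarrow> ('i \<Rightarrow> 'i) \<Rightarrow> bool" where
  "subdivision I M J N s \<longleftrightarrow>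
     (\<forall>j\<in>J. s j \<in> I) \<and> (\<forall>i\<in>I. M i = (\<Union>j\<in>{j\<in>J. s j = i}. N j))"

definition symbolic_image ::
    "('a \<Rightarrow> 'a) \<Rightarrow> 'i set \<Rightarrow> ('i \<Rightarrow> 'a set) \<Rightarrow> ('i, 'i \<times> 'i) pre_digraph" where
  "symbolic_image f I M =
     \<lparr>verts = I, arcs = {(i, j). i \<in> I \<and> j \<in> I \<and> f ` M i \<inter> M j \<noteq> {}}, tail = fst, head = snd\<rparr>"

lemma symbolic_image_arc_map:
  assumes "subdivision I M J N s" and "(p, q) \<in> arcs (symbolic_image f J N)"
  shows "(s p, s q) \<in> arcs (symbolic_image f I M)"
proof -
  have "p \<in> J" "q \<in> J" "f ` N p \<inter> N q \<noteq> {}"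
    using assms(2) by (auto simp: symbolic_image_def)
  moreover have "N r \<subseteq> M (s r)" "s r \<in> I" if "r \<in> J" for r
    using assms(1) that unfolding subdivision_def by blast+
  ultimately show ?thesis
    by (simp add: symbolic_image_def) blast
qed


section \<open>Flows on directed graphs\<close>

text \<open>A flow is extended by zero outside the set of arcs.\<close>

definition flow :: "('i, 'e) pre_digraph \<Rightarrow> ('e \<Rightarrow> real) \<Rightarrow> bool" where
  "flow G m \<longleftrightarrow>
     (\<forall>a\<in>arcs G. 0 \<le> m a) \<and> (\<forall>a. a \<notin> arcs G \<longrightarrow> m a = 0) \<and>
     (\<Sum>a\<in>arcs G. m a) = 1 \<and>
     (\<forall>i\<in>verts G. (\<Sum>a\<in>in_arcs G i. m a) = (\<Sum>a\<in>out_arcs G i. m a))"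

definition vertex_measure :: "('i, 'e) pre_digraph \<Rightarrow> ('e \<Rightarrow> real) \<Rightarrow> 'i \<Rightarrow> real" where
  "vertex_measure G m i = (\<Sum>a\<in>out_arcs G i. m a)"

text \<open>\<open>cycle\<close> is given by the list of its arcs, with all its vertices distinct; loops are cycles.\<close>

definition simple_flow :: "('i, 'e) pre_digraph \<Rightarrow> ('e \<Rightarrow> real) \<Rightarrow> bool" where
  "simple_flow G m \<longleftrightarrow>
     (\<exists>\<omega>. pre_digraph.cycle G \<omega> \<and> m = (\<lambda>a. if a \<in> set \<omega> then 1 / real (length \<omega>) else 0))"

definition push_flow ::
    "('i, 'i \<times> 'i) pre_digraph \<Rightarrow> ('i \<Rightarrow> 'i) \<Rightarrow> ('i \<times> 'i \<Rightarrow> real) \<Rightarrow> 'i \<times> 'i \<Rightarrow> real" where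
  "push_flow Q s m b = (\<Sum>a\<in>{a\<in>arcs Q. map_prod s s a = b}. m a)"

definition consistent_flows ::
    "(nat \<Rightarrow> ('i, 'i \<times> 'i) pre_digraph) \<Rightarrow> (nat \<Rightarrow> 'i \<Rightarrow> 'i) \<Rightarrow> (nat \<Rightarrow> 'i \<times> 'i \<Rightarrow> real) \<Rightarrow> bool" where
  "consistent_flows G s m \<longleftrightarrow>
     (\<forall>k. flow (G k) (m k)) \<and> (\<forall>k. push_flow (G (Suc k)) (s k) (m (Suc k)) = m k)"


section \<open>Measures on the manifold\<close>

definition cell_measure ::
    "'a::topological_space measure \<Rightarrow> 'i set \<Rightarrow> ('i \<Rightarrow> 'a set) \<Rightarrow> ('i \<Rightarrow> real) \<Rightarrow> 'a measure" where
  "cell_measure v I M w =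
     measure_of UNIV (sets borel)
       (\<lambda>B. \<Sum>i\<in>I. ennreal (w i) * (emeasure v (B \<inter> M i) / emeasure v (M i)))"

lemma sets_cell_measure [simp]: "sets (cell_measure v I M w) = sets borel"
  using sets.sigma_sets_eq[of borel]
  by (simp add: cell_measure_def sets_measure_of)

lemma emeasure_cell_measure:
  assumes v: "sets v = sets borel" and M: "\<And>i. i \<in> I \<Longrightarrow> closed (M i)" and B: "B \<in> sets borel"
  shows "emeasure (cell_measure v I M w) B =
           (\<Sum>i\<in>I. ennreal (w i) * (emeasure v (B \<inter> M i) / emeasure v (M i)))"
proof (rule emeasure_measure_of[OF cell_measure_def])
  show "countably_additive (sets (cell_measure v I M w))
          (\<lambda>B. \<Sum>i\<in>I. ennreal (w i) * (emeasure v (B \<inter> M i) / emeasure v (M i)))"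
  proof (rule countably_additiveI)
    fix A :: "nat \<Rightarrow> 'a set"
    assume A: "range A \<subseteq> sets (cell_measure v I M w)" "disjoint_family A"
    have "(\<Sum>n. emeasure v (A n \<inter> M i)) = emeasure v ((\<Union>n. A n) \<inter> M i)" if "i \<in> I" for i
    proof -
      have "range (\<lambda>n. A n \<inter> M i) \<subseteq> sets v"
        using A(1) M[OF that] v by fastforce
      moreover have "disjoint_family (\<lambda>n. A n \<inter> M i)"
        using A(2) by (auto simp: disjoint_family_on_def)
      ultimately show ?thesis
        by (subst suminf_emeasure) simp_all
    qed
    then show "(\<Sum>n. \<Sum>i\<in>I. ennreal (w i) * (emeasure v (A n \<inter> M i) / emeasure v (M i))) =
      (\<Sum>i\<in>I. ennreal (w i) * (emeasure v ((\<Union>n. A n) \<inter> M i) / emeasure v (M i)))"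
      by (subst suminf_sum) (auto simp: divide_ennreal_def ennreal_suminf_multc)
  qed
qed (use B in \<open>auto simp: positive_def\<close>)

definition weakly_converges ::
    "(nat \<Rightarrow> 'a::topological_space measure) \<Rightarrow> 'a measure \<Rightarrow> bool" where
  "weakly_converges \<mu>s \<mu> \<longleftrightarrow>
     (\<forall>\<phi> :: 'a \<Rightarrow> real. continuous_on UNIV \<phi> \<longrightarrow>
        (\<lambda>k. \<integral>x. \<phi> x \<partial>(\<mu>s k)) \<longlonglongrightarrow> (\<integral>x. \<phi> x \<partial>\<mu>))"

definition invariant_measure :: "('a::topological_space \<Rightarrow> 'a) \<Rightarrow> 'a measure \<Rightarrow> bool" where
  "invariant_measure f \<mu> \<longleftrightarrow>
     sets \<mu> = sets borel \<and> emeasure \<mu> UNIV = 1 \<and>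
     (\<forall>B\<in>sets borel. emeasure \<mu> (f -` B) = emeasure \<mu> B \<and> emeasure \<mu> (f ` B) = emeasure \<mu> B)"

definition ergodic_measure :: "('a::topological_space \<Rightarrow> 'a) \<Rightarrow> 'a measure \<Rightarrow> bool" where
  "ergodic_measure f \<mu> \<longleftrightarrow>
     invariant_measure f \<mu> \<and>
     (\<forall>B\<in>sets borel. f -` B = B \<longrightarrow> emeasure \<mu> B = 0 \<or> emeasure \<mu> (- B) = 0)"

end

theory Submission
  imports Defs
begin

text \<open>
  Since \<open>s\<close> maps the simple cycle of \<open>G\<^sub>k\<^sub>+\<^sub>1\<close> to arcs of the simple cycle of \<open>G\<^sub>k\<close>, it winds the former around
  the latter. Hence the cycles have periods \<open>p 0 dvd p 1 dvd \<dots>\<close> and their inverse limit is an odometer.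
  A point of the odometer is a nested sequence of cells, which determines a point of the manifold, and
  as \<open>f\<close> maps every cell of a cycle onto a set meeting the next one, this coding conjugates the odometer
  to \<open>f\<close>. The limit measure is the image of the Haar measure of the odometer. It gives an open set \<open>U\<close>
  the limit of the fractions of cells of the cycles lying inside \<open>U\<close>. During \<open>p k\<close> steps every coded
  orbit passes each cell of level \<open>k\<close>, so \<open>\<mu> (B \<inter> U) \<ge> \<mu> B * \<mu> U\<close> for invariant \<open>B\<close>; the same bound for
  the complement of \<open>B\<close> makes this an equality, so that \<open>\<mu> B = (\<mu> B)\<^sup>2\<close>.
\<close>

section \<open>Cycles of consistent simple flows\<close>

text \<open>Neighbouring cells may share boundary points, so a point of the manifold can lie in
  several cells of one cycle, and labels cannot simply be read off from points. Two choices answer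
  this. First, coded points enter through the relation \<open>point_of\<close>, membership in every
  cell of a nested sequence, and the dynamics becomes a shift of indices in that relation. Second,
  open sets are measured from inside: a cell contained in an open set certifies all its points, a
  cell that merely meets it certifies nothing. Each finite level therefore gives only a lower bound,
  and an equality needs a companion bound; for invariance it comes from \<open>inv f\<close>. The
  limit measure is constructed before convergence is discussed; weak convergence is then dominated
  convergence for the averages of a continuous function over the cells around a coded point.
  Geometry has to supply two facts: cells of small Riemannian diameter fit into a given
  neighbourhood, and the volume is finite.\<close>

definition cycle_enumeration ::
    "('a \<Rightarrow> 'a) \<Rightarrow> 'i set \<Rightarrow> ('i \<Rightarrow> 'a set) \<Rightarrow> ('i \<times> 'i \<Rightarrow> real) \<Rightarrow> nat \<Rightarrow> (nat \<Rightarrow> 'i) \<Rightarrow> bool" where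
  "cycle_enumeration f I M m p c \<longleftrightarrow>
     0 < p \<and> inj_on c {..<p} \<and> (\<forall>j. c (j + p) = c j) \<and> range c \<subseteq> I \<and>
     (\<forall>j. f ` M (c j) \<inter> M (c (Suc j)) \<noteq> {}) \<and>
     m = (\<lambda>a. if a \<in> range (\<lambda>j. (c j, c (Suc j))) then 1 / real p else 0)"

lemma cycle_enumerationI:
  assumes "0 < p" "inj_on c {..<p}" "\<And>j. c (j + p) = c j" "\<And>j. c j \<in> I"
    "\<And>j. f ` M (c j) \<inter> M (c (Suc j)) \<noteq> {}"
    "m = (\<lambda>a. if a \<in> range (\<lambda>j. (c j, c (Suc j))) then 1 / real p else 0)"
  shows "cycle_enumeration f I M m p c"
  using assms unfolding cycle_enumeration_def by blast

lemma periodic_mod: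
  fixes c :: "nat \<Rightarrow> 'b"
  assumes "\<And>j. c (j + p) = c j"
  shows "c (j mod p) = c j"
proof -
  have "c (i + p * n) = c i" for i n
  proof (induction n)
    case (Suc n)
    have "c (i + p * Suc n) = c ((i + p * n) + p)" by (simp add: algebra_simps)
    then show ?case using Suc assms by simp
  qed simp
  from this[of "j mod p" "j div p"] show ?thesis by simp
qed

lemma periodic_eq_iff:
  fixes c :: "nat \<Rightarrow> 'b"
  assumes "\<And>j. c (j + p) = c j" "inj_on c {..<p}" "0 < p"
  shows "c i = c j \<longleftrightarrow> i mod p = j mod p"
proof
  assume "c i = c j"
  then have "c (i mod p) = c (j mod p)" by (simp add: periodic_mod[of c, OF assms(1)])
  then show "i mod p = j mod p" using inj_onD[OF assms(2)] assms(3) by simp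
next
  assume "i mod p = j mod p"
  then show "c i = c j" using periodic_mod[of c, OF assms(1)] by metis
qed

text \<open>Reading a walk both by heads and by tails lets distinctness pass from the heads of a
  closed walk to its tails.\<close>

lemma (in pre_digraph) awalk_verts_cas:
  assumes "cas u w v"
  shows "awalk_verts u w = u # map (head G) w" "awalk_verts u w = map (tail G) w @ [v]"
  using assms by (induction w arbitrary: u) auto

text \<open>The list of arcs becomes the periodic sequence of their tails, defined for all natural
  numbers so that later shifts and windings need no wraparound.\<close>

lemma simple_flow_enumeration:
  assumes "simple_flow (symbolic_image f I M) m"
  shows "\<exists>p c. cycle_enumeration f I M m p c"
proof -
  let ?G = "symbolic_image f I M"
  obtain w u where w: "pre_digraph.awalk ?G u w u" "distinct (tl (pre_digraph.awalk_verts ?G u w))" "w \<noteq> []"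
    and m: "m = (\<lambda>a. if a \<in> set w then 1 / real (length w) else 0)"
    using assms unfolding simple_flow_def pre_digraph.cycle_def by blast
  have cas: "pre_digraph.cas ?G u w u" and arcs: "set w \<subseteq> arcs ?G"
    using w(1) unfolding pre_digraph.awalk_def by auto
  have th: "tail ?G = fst" "head ?G = snd" by (simp_all add: symbolic_image_def)
  have e1: "pre_digraph.awalk_verts ?G u w = u # map snd w"
    and e2: "u # map snd w = map fst w @ [u]"
    using pre_digraph.awalk_verts_cas[OF cas] th by auto
  \<comment> \<open>Distinctness is known for the heads, the \<open>tl\<close> of the vertex list.
    Both readings contain \<open>u\<close> once more, so heads and tails agree as multisets.\<close>
  have "mset (u # map snd w) = mset (map fst w @ [u])" using e2 by simp
  then have "mset (map snd w) = mset (map fst w)" by simp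
  with w(2) e1 have dist: "distinct (map fst w)"
    by (metis list.sel(3) mset_eq_imp_distinct_iff)
  define p where "p = length w"
  have p: "0 < p" using w(3) by (simp add: p_def)
  define c where "c j = map fst w ! (j mod p)" for j
  have snd_w: "snd (w ! i) = c (Suc i)" if "i < p" for i
  proof -
    have "snd (w ! i) = (u # map snd w) ! Suc i" using that by (simp add: p_def)
    also have "\<dots> = (map fst w @ [u]) ! Suc i" using e2 by simp
    also have "\<dots> = c (Suc i)"
    proof (cases "Suc i < p")
      case True
      then show ?thesis by (simp add: nth_append p_def c_def)
    next
      case False
      then have S: "Suc i = p" using that by simp
      have "u = (u # map snd w) ! 0" by simp
      also have "\<dots> = map fst w ! 0" unfolding e2 using p by (simp add: nth_append p_def)
      finally show ?thesis unfolding S by (simp add: nth_append p_def c_def)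
    qed
    finally show ?thesis .
  qed
  have w_nth: "w ! (j mod p) = (c j, c (Suc j))" for j
  proof -
    have "j mod p < p" using p by simp
    moreover have "c (Suc (j mod p)) = c (Suc j)" by (simp add: c_def mod_Suc_eq)
    moreover have "fst (w ! (j mod p)) = c j" using p by (simp add: c_def p_def)
    ultimately show ?thesis using snd_w[of "j mod p"] by (simp add: prod_eq_iff)
  qed
  have setw: "set w = range (\<lambda>j. (c j, c (Suc j)))"
  proof
    show "set w \<subseteq> range (\<lambda>j. (c j, c (Suc j)))"
    proof
      fix a assume "a \<in> set w"
      then obtain i where "i < p" "a = w ! i" by (auto simp: in_set_conv_nth p_def)
      then have "a = (c i, c (Suc i))" using w_nth[of i] by simp
      then show "a \<in> range (\<lambda>j. (c j, c (Suc j)))" by (rule image_eqI) simp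
    qed
    show "range (\<lambda>j. (c j, c (Suc j))) \<subseteq> set w"
    proof (rule image_subsetI)
      fix j
      have "j mod p < length w" using p by (simp add: p_def)
      then have "w ! (j mod p) \<in> set w" by (rule nth_mem)
      then show "(c j, c (Suc j)) \<in> set w" by (simp only: w_nth)
    qed
  qed
  have "inj_on c {..<p}"
    using dist nth_eq_iff_index_eq[of "map fst w"] unfolding inj_on_def c_def p_def by simp
  moreover have "c (j + p) = c j" for j by (simp add: c_def)
  moreover have "c j \<in> I \<and> f ` M (c j) \<inter> M (c (Suc j)) \<noteq> {}" for j
  proof -
    have "(c j, c (Suc j)) \<in> set w" unfolding setw by (rule rangeI)
    then show ?thesis using arcs by (auto simp: symbolic_image_def)
  qed
  ultimately have "cycle_enumeration f I M m p c"
    unfolding m setw p_def[symmetric] using p by (intro cycle_enumerationI) blast+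
  then show ?thesis by blast
qed

lemma cycle_enumeration_shift:
  assumes "cycle_enumeration f I M m p c"
  shows "cycle_enumeration f I M m p (\<lambda>j. c (j + b))"
proof -
  have p: "0 < p" and inj: "inj_on c {..<p}" and per: "\<And>j. c (j + p) = c j" and I: "range c \<subseteq> I"
    and meets: "\<And>j. f ` M (c j) \<inter> M (c (Suc j)) \<noteq> {}"
    and m: "m = (\<lambda>a. if a \<in> range (\<lambda>j. (c j, c (Suc j))) then 1 / real p else 0)"
    using assms unfolding cycle_enumeration_def by blast+
  show ?thesis
  proof (rule cycle_enumerationI)
    show "0 < p" by (rule p)
    show "inj_on (\<lambda>j. c (j + b)) {..<p}"
  proof (rule inj_onI)
    fix i j assume ij: "i \<in> {..<p}" "j \<in> {..<p}" "c (i + b) = c (j + b)"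
    then have "(i + b) mod p = (j + b) mod p" using periodic_eq_iff[OF per inj p] by simp
    \<comment> \<open>\<open>p * b - b\<close> serves as the negative of \<open>b\<close> modulo
      \<open>p\<close>; the subtraction is exact because \<open>p\<close> is positive.\<close>
    have *: "l + b + (p * b - b) = l + p * b" for l
      using p by (cases p) auto
    have "((i + b) mod p + (p * b - b)) mod p = ((j + b) mod p + (p * b - b)) mod p"
      using \<open>(i + b) mod p = (j + b) mod p\<close> by (rule arg_cong)
    then have "i mod p = j mod p" by (simp only: mod_add_left_eq * mod_mult_self2)
    then show "i = j" using ij by simp
  qed
  have "range (\<lambda>j. (c (j + b), c (Suc j + b))) = range (\<lambda>j. (c j, c (Suc j)))"
  proof
    show "range (\<lambda>j. (c j, c (Suc j))) \<subseteq> range (\<lambda>j. (c (j + b), c (Suc j + b)))"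
    proof
      fix a assume "a \<in> range (\<lambda>j. (c j, c (Suc j)))"
      then obtain j where a: "a = (c j, c (Suc j))" by blast
      have "b \<le> p * b" using p by (cases p) auto
      then have e: "(j + (p * b - b)) + b = j + p * b" by linarith
      have "c (j + (p * b - b) + b) = c j" "c (Suc (j + (p * b - b)) + b) = c (Suc j)"
        unfolding add_Suc e periodic_eq_iff[OF per inj p] using mod_mult_self2[of "Suc j"] by simp_all
      then show "a \<in> range (\<lambda>j. (c (j + b), c (Suc j + b)))"
        unfolding a by (intro image_eqI[where x = "j + (p * b - b)"]) simp_all
    qed
  qed auto
    then show "m = (\<lambda>a. if a \<in> range (\<lambda>j. (c (j + b), c (Suc j + b))) then 1 / real p else 0)"
      by (simp only: m)
    show "c (j + p + b) = c (j + b)" for j using per[of "j + b"] by (simp add: ac_simps)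
    show "f ` M (c (j + b)) \<inter> M (c (Suc j + b)) \<noteq> {}" for j using meets[of "j + b"] by simp
    show "c (j + b) \<in> I" for j using I by blast
  qed
qed

text \<open>The positive mass of an arc of the finer cycle is pushed to its image, where nothing can
  cancel it, so the image is an arc of the coarser cycle. There a vertex determines its successor,
  so the images run round the coarse cycle in order; \<open>b\<close> aligns the starting
  vertices.\<close>

lemma push_flow_enumeration:
  assumes c: "cycle_enumeration f I M m p c" and c': "cycle_enumeration f J N m' q c'"
    and fin: "finite J" and push: "push_flow (symbolic_image f J N) s m' = m"
  shows "\<exists>b. \<forall>j. s (c' (j + b)) = c j"
proof -
  have p: "0 < p" and inj: "inj_on c {..<p}" and per: "\<And>j. c (j + p) = c j"
    and m: "m = (\<lambda>a. if a \<in> range (\<lambda>j. (c j, c (Suc j))) then 1 / real p else 0)"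
    using c unfolding cycle_enumeration_def by blast+
  have q: "0 < q" and J: "range c' \<subseteq> J" and meets: "\<And>j. f ` N (c' j) \<inter> N (c' (Suc j)) \<noteq> {}"
    and m': "m' = (\<lambda>a. if a \<in> range (\<lambda>j. (c' j, c' (Suc j))) then 1 / real q else 0)"
    using c' unfolding cycle_enumeration_def by blast+
  let ?Q = "symbolic_image f J N"
  have arc: "\<exists>i. s (c' j) = c i \<and> s (c' (Suc j)) = c (Suc i)" for j
  proof -
    let ?a = "(c' j, c' (Suc j))" and ?b = "(s (c' j), s (c' (Suc j)))"
    have "arcs ?Q \<subseteq> J \<times> J" by (auto simp: symbolic_image_def)
    then have "finite (arcs ?Q)" using fin finite_subset by blast
    moreover have "?a \<in> arcs ?Q" using J meets by (auto simp: symbolic_image_def)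
    ultimately have "m' ?a \<le> (\<Sum>a\<in>{a\<in>arcs ?Q. map_prod s s a = ?b}. m' a)"
      by (intro member_le_sum) (auto simp: m')
    moreover have "0 < m' ?a" using q by (auto simp: m')
    ultimately have "0 < m ?b"
      unfolding push[symmetric] push_flow_def by linarith
    then show ?thesis unfolding m by (auto split: if_splits)
  qed
  obtain a where a: "s (c' 0) = c a" using arc by blast
  have "s (c' j) = c (j + a)" for j
  proof (induction j)
    case (Suc j)
    obtain i where "s (c' j) = c i" "s (c' (Suc j)) = c (Suc i)" using arc by blast
    with Suc have "i mod p = (j + a) mod p" using periodic_eq_iff[OF per inj p] by metis
    then have "c (Suc i) = c (Suc (j + a))"
      unfolding periodic_eq_iff[OF per inj p] by (metis mod_Suc_eq)
    then show ?case using \<open>s (c' (Suc j)) = _\<close> by simp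
  qed (simp add: a)
  \<comment> \<open>Advancing by \<open>p * a - a\<close> completes the offset \<open>a\<close> to a
    multiple of the period.\<close>
  then have "s (c' (j + (p * a - a))) = c j" for j
  proof -
    assume *: "\<And>j. s (c' j) = c (j + a)"
    have "a \<le> p * a" using p by (cases p) auto
    then have e: "(j + (p * a - a)) + a = j + p * a" by linarith
    show ?thesis unfolding * e periodic_eq_iff[OF per inj p] by simp
  qed
  then show ?thesis by blast
qed

text \<open>Each vertex of a simple cycle has exactly one outgoing arc carrying flow, so the weights
  in \<open>cell_measure\<close> are uniform along the cycle.\<close>

lemma vertex_measure_enumeration:
  assumes c: "cycle_enumeration f I M m p c" and fin: "finite I"
  shows "vertex_measure (symbolic_image f I M) m i = (if i \<in> range c then 1 / real p else 0)"
proof -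
  have p: "0 < p" and inj: "inj_on c {..<p}" and per: "\<And>j. c (j + p) = c j" and I: "range c \<subseteq> I"
    and meets: "\<And>j. f ` M (c j) \<inter> M (c (Suc j)) \<noteq> {}"
    and m: "m = (\<lambda>a. if a \<in> range (\<lambda>j. (c j, c (Suc j))) then 1 / real p else 0)"
    using assms unfolding cycle_enumeration_def by blast+
  let ?O = "out_arcs (symbolic_image f I M) i"
  have "?O \<subseteq> I \<times> I" by (auto simp: symbolic_image_def out_arcs_def)
  then have finO: "finite ?O" using fin finite_subset by blast
  show ?thesis
  proof (cases "i \<in> range c")
    case True
    then obtain j where j: "i = c j" by blast
    have "m e = (if e = (c j, c (Suc j)) then 1 / real p else 0)" if "e \<in> ?O" for e
    proof -
      have "e = (c j, c (Suc j))" if "e = (c l, c (Suc l))" for l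
      proof -
        have "c l = c j" using that \<open>e \<in> ?O\<close> j by (simp add: out_arcs_def symbolic_image_def)
        then have "l mod p = j mod p" using periodic_eq_iff[OF per inj p] by simp
        then have "c (Suc l) = c (Suc j)"
          unfolding periodic_eq_iff[OF per inj p] by (metis mod_Suc_eq)
        then show ?thesis using that \<open>c l = c j\<close> by simp
      qed
      then have "e \<in> range (\<lambda>l. (c l, c (Suc l))) \<longleftrightarrow> e = (c j, c (Suc j))" by blast
      then show ?thesis unfolding m by (rule arg_cong)
    qed
    then have "(\<Sum>e\<in>?O. m e) = (\<Sum>e\<in>?O. if e = (c j, c (Suc j)) then 1 / real p else 0)" by simp
    also have "\<dots> = 1 / real p"
    proof -
      have "(c j, c (Suc j)) \<in> ?O" using I meets[of j] j by (auto simp: out_arcs_def symbolic_image_def)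
      then show ?thesis using finO by (simp add: sum.delta)
    qed
    finally show ?thesis using True by (simp add: vertex_measure_def)
  next
    case False
    then have "m e = 0" if "e \<in> ?O" for e
    proof -
      have "fst e = i" using that by (simp add: out_arcs_def symbolic_image_def)
      then have "e \<notin> range (\<lambda>j. (c j, c (Suc j)))" using False by force
      then show ?thesis by (simp add: m)
    qed
    then show ?thesis using False by (simp add: vertex_measure_def)
  qed
qed

text \<open>The alignment at one level depends on the enumeration chosen at the previous one, hence
  dependent choice. Only the enumerations are carried along; the periods stay existential and are
  picked at the end.\<close>

lemma coherent_cycle_enumerations:
  fixes f :: "'a \<Rightarrow> 'a" and I :: "nat \<Rightarrow> 'i set"
  assumes simple: "\<And>k. simple_flow (symbolic_image f (I k) (M k)) (m k)"
    and fin: "\<And>k. finite (I k)"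
    and push: "\<And>k. push_flow (symbolic_image f (I (Suc k)) (M (Suc k))) (s k) (m (Suc k)) = m k"
  obtains p c where "\<And>k. cycle_enumeration f (I k) (M k) (m k) (p k) (c k)"
    "\<And>k j. s k (c (Suc k) j) = c k j"
proof -
  let ?E = "\<lambda>k p c. cycle_enumeration f (I k) (M k) (m k) p c"
  have 1: "\<exists>p c. ?E k p c" for k
    by (rule simple_flow_enumeration[OF simple])
  have 2: "\<exists>c'. (\<exists>q. ?E (Suc k) q c') \<and> (\<forall>j. s k (c' j) = c j)" if ex: "\<exists>p. ?E k p c" for k c
  proof -
    obtain p where p: "?E k p c" using ex by blast
    obtain q c' where c': "?E (Suc k) q c'" using 1[of "Suc k"] by blast
    obtain b where "\<forall>j. s k (c' (j + b)) = c j"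
      using push_flow_enumeration[OF p c' fin push] by blast
    then show ?thesis using cycle_enumeration_shift[OF c', of b] by blast
  qed
  have "\<exists>c. \<forall>k. (\<exists>p. ?E k p (c k)) \<and> (\<forall>j. s k (c (Suc k) j) = c k j)"
  proof (rule dependent_nat_choice[where P = "\<lambda>k c. \<exists>p. ?E k p c"
        and Q = "\<lambda>k c c'. \<forall>j. s k (c' j) = c j"])
    show "\<exists>c p. ?E 0 p c" using 1[of 0] by (subst ex_comm)
  qed (rule 2)
  then obtain c where c: "\<forall>k. (\<exists>p. ?E k p (c k)) \<and> (\<forall>j. s k (c (Suc k) j) = c k j)" ..
  then have "\<forall>k. \<exists>p. ?E k p (c k)" by blast
  then have "\<exists>p. \<forall>k. ?E k (p k) (c k)" by (rule choice)
  then obtain p where "\<forall>k. ?E k (p k) (c k)" ..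
  with c show thesis by (intro that) blast+
qed


text \<open>Inclusion of cells gives access to open sets only; agreement there passes to Borel sets
  because open sets form a generator stable under intersection.\<close>

lemma borel_measure_eqI_open:
  assumes "sets M = sets borel" "sets N = sets borel" "emeasure M UNIV \<noteq> \<infinity>"
    and "\<And>U. open U \<Longrightarrow> emeasure M U = emeasure N U"
  shows "M = N"
proof (rule measure_eqI_generator_eq[where E = "Collect open" and \<Omega> = UNIV and A = "\<lambda>_. UNIV"])
  show "Int_stable (Collect open :: 'a set set)" by (auto simp: Int_stable_def)
qed (use assms in \<open>auto simp: borel_def\<close>)

lemma sum_shift_periodic:
  fixes g :: "nat \<Rightarrow> 'b::comm_monoid_add"
  assumes "\<And>j. g (j + p) = g j"
  shows "(\<Sum>j<p. g (j + d)) = (\<Sum>j<p. g j)"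
proof (induction d)
  case (Suc d)
  show ?case
  proof (cases p)
    case (Suc q)
    have "(\<Sum>j<Suc q. g (j + Suc d)) = (\<Sum>j<q. g (Suc j + d)) + g (Suc q + d)" by simp
    \<comment> \<open>The term gained at the end of the shifted window equals the one lost at its
      start.\<close>
    also have "g (Suc q + d) = g (0 + d)"
      using assms[of d] unfolding \<open>p = Suc q\<close> by (simp only: add_0 add.commute)
    also have "(\<Sum>j<q. g (Suc j + d)) + g (0 + d) = (\<Sum>j<Suc q. g (j + d))"
      unfolding sum.lessThan_Suc_shift by (simp only: add.commute)
    finally show ?thesis using Suc.IH unfolding \<open>p = Suc q\<close> by (rule trans)
  qed simp
qed simp

section \<open>Odometers\<close>

abbreviation unit_measure :: "real measure" where
  "unit_measure \<equiv> restrict_space lborel {0..<1}"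

lemma prob_space_unit_measure: "prob_space unit_measure"
  by (rule prob_spaceI) (simp add: emeasure_restrict_space)

locale odometer =
  fixes p :: "nat \<Rightarrow> nat"
  assumes p_pos: "0 < p k" and p_dvd: "p k dvd p (Suc k)"
begin

text \<open>The intervals \<open>[q / p k, (q + 1) / p k)\<close> are labelled by residues modulo \<open>p k\<close> so that the
  subintervals of an interval with label \<open>j\<close> get the labels congruent to \<open>j\<close> modulo \<open>p k\<close>. Then Lebesgue
  measure on \<open>[0, 1)\<close> represents the Haar measure of the odometer.\<close>

primrec digits :: "nat \<Rightarrow> nat \<Rightarrow> nat" where
  "digits 0 q = q"
| "digits (Suc k) q = digits k (q div (p (Suc k) div p k)) + p k * (q mod (p (Suc k) div p k))"

definition residue :: "nat \<Rightarrow> real \<Rightarrow> nat" where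
  "residue k t = digits k (nat \<lfloor>t * real (p k)\<rfloor>)"

section \<open>Residue labels of the subintervals of [0, 1)\<close>

lemma p_Suc: "p (Suc k) = p (Suc k) div p k * p k" "0 < p (Suc k) div p k"
  using p_dvd[of k] p_pos[of k] dvd_imp_le[OF p_dvd[of k] p_pos[of "Suc k"]]
  by (simp_all add: div_greater_zero_iff)

lemma div_less_p: "q < p (Suc k) \<Longrightarrow> q div (p (Suc k) div p k) < p k"
  by (rule less_mult_imp_div_less) (simp only: p_Suc(1)[of k, symmetric] mult.commute[of "p k"])

lemma digits_less: "q < p k \<Longrightarrow> digits k q < p k"
proof (induction k arbitrary: q)
  case (Suc k)
  define r where "r = p (Suc k) div p k"
  have r: "p (Suc k) = r * p k" "0 < r" unfolding r_def by (rule p_Suc)+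
  have "digits k (q div r) + p k * (q mod r) < p k + p k * (q mod r)"
    using Suc.IH[OF div_less_p[OF Suc.prems]] by (simp add: r_def)
  also have "\<dots> = p k * Suc (q mod r)" by simp
  also have "\<dots> \<le> p k * r" using r(2) by (intro mult_le_mono2) (simp add: Suc_leI)
  also have "p k * r = p (Suc k)" using r(1) by (rule trans[OF mult.commute sym])
  finally show ?case unfolding digits.simps r_def[symmetric] .
qed simp

text \<open>Reducing a label modulo \<open>p k\<close> recovers the label of the parent interval;
  what remains gives the position inside the parent.\<close>

lemma inj_on_digits: "inj_on (digits k) {..<p k}"
proof (induction k)
  case (Suc k)
  define r where "r = p (Suc k) div p k"
  show ?case
  proof (rule inj_onI)
    fix a b assume ab: "a \<in> {..<p (Suc k)}" "b \<in> {..<p (Suc k)}" "digits (Suc k) a = digits (Suc k) b"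
    have l: "a div r < p k" "b div r < p k" using ab unfolding r_def by (simp_all add: div_less_p)
    have e: "digits k (a div r) + p k * (a mod r) = digits k (b div r) + p k * (b mod r)"
      using ab(3) by (simp add: r_def)
    then have "(digits k (a div r) + p k * (a mod r)) mod p k = (digits k (b div r) + p k * (b mod r)) mod p k"
      by (rule arg_cong)
    then have d: "digits k (a div r) = digits k (b div r)" using digits_less[OF l(1)] digits_less[OF l(2)] by simp
    then have mod: "a mod r = b mod r" using e p_pos[of k] by simp
    have div: "a div r = b div r" using inj_onD[OF Suc.IH d] l by simp
    have "a = a div r * r + a mod r" by (rule div_mult_mod_eq[symmetric])
    also have "\<dots> = b" unfolding mod div by (rule div_mult_mod_eq)
    finally show "a = b" .
  qed
qed (simp add: inj_on_def)

lemma bij_betw_digits: "bij_betw (digits k) {..<p k} {..<p k}"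
  unfolding bij_betw_def
  by (intro conjI inj_on_digits endo_inj_surj) (auto simp: digits_less)

lemma floor_less: "t \<in> {0..<1} \<Longrightarrow> nat \<lfloor>t * real (p k)\<rfloor> < p k"
  using p_pos[of k] by (auto simp: nat_less_iff floor_less_iff)

lemma residue_less: "t \<in> {0..<1} \<Longrightarrow> residue k t < p k"
  unfolding residue_def by (rule digits_less[OF floor_less])

text \<open>The index of an interval at level \<open>k\<close> is the quotient of the finer index,
  and \<open>digits\<close> then adds only a multiple of \<open>p k\<close>. This makes the labels
  of \<open>t\<close> a point of the odometer.\<close>

lemma residue_Suc_mod:
  assumes "t \<in> {0..<1}"
  shows "residue (Suc k) t mod p k = residue k t"
proof -
  define r where "r = p (Suc k) div p k"
  have r: "p (Suc k) = r * p k" "0 < r" unfolding r_def by (rule p_Suc)+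
  then have "t * real (p k) = t * real (p (Suc k)) / real_of_int (int r)" by simp
  then have "\<lfloor>t * real (p k)\<rfloor> = \<lfloor>t * real (p (Suc k))\<rfloor> div int r"
    by (simp only: floor_divide_real_eq_div of_nat_0_le_iff)
  then have "nat \<lfloor>t * real (p k)\<rfloor> = nat \<lfloor>t * real (p (Suc k))\<rfloor> div r"
    using assms by (simp add: nat_div_distrib)
  then have "residue (Suc k) t = residue k t + p k * (nat \<lfloor>t * real (p (Suc k))\<rfloor> mod r)"
    by (simp add: residue_def r_def)
  then show ?thesis using residue_less[OF assms] by simp
qed

lemma measurable_residue [measurable]: "residue k \<in> measurable unit_measure (count_space UNIV)"
  unfolding residue_def by (rule measurable_restrict_space1) measurable

text \<open>\<open>digits\<close> permutes the labels, so each label names a single interval of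
  length \<open>1 / p k\<close>. Equal weights at every level characterize the Haar measure.\<close>

lemma measure_residue_eq:
  assumes "j < p k"
  shows "measure unit_measure {t \<in> {0..<1}. residue k t = j} = 1 / real (p k)"
proof -
  have "j \<in> digits k ` {..<p k}"
    using bij_betw_imp_surj_on[OF bij_betw_digits[of k]] assms by simp
  then obtain q where q: "q < p k" "digits k q = j" by blast
  have p: "0 < real (p k)" using p_pos by simp
  have iff: "residue k t = j \<longleftrightarrow> real q / p k \<le> t \<and> t < real (Suc q) / p k" if "t \<in> {0..<1}" for t
  proof -
    have "residue k t = j \<longleftrightarrow> nat \<lfloor>t * real (p k)\<rfloor> = q"
      unfolding residue_def q(2)[symmetric]
      using inj_on_eq_iff[OF inj_on_digits] floor_less[OF that] q(1) by simp
    \<comment> \<open>\<open>nat\<close> sends negative numbers to 0; the floor is nonnegative here,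
      so this cannot interfere even for \<open>q = 0\<close>.\<close>
    moreover have "nat \<lfloor>t * real (p k)\<rfloor> = q \<longleftrightarrow> \<lfloor>t * real (p k)\<rfloor> = int q"
    proof -
      have "0 \<le> \<lfloor>t * real (p k)\<rfloor>" using that by simp
      then show ?thesis by linarith
    qed
    moreover have "\<lfloor>t * real (p k)\<rfloor> = int q \<longleftrightarrow> real q \<le> t * real (p k) \<and> t * real (p k) < real (Suc q)"
      by (simp add: floor_eq_iff add.commute)
    ultimately show ?thesis using p by (simp add: field_simps)
  qed
  have b: "0 \<le> real q / p k" "real (Suc q) / p k \<le> 1" using q p by auto
  have sub: "{real q / p k..<real (Suc q) / p k} \<subseteq> {0..<1}"
    using order_trans[OF b(1)] order.strict_trans2[OF _ b(2)] by fastforce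
  have eq: "{t \<in> {0..<1}. residue k t = j} = {real q / p k..<real (Suc q) / p k}"
  proof (rule set_eqI)
    fix t
    show "t \<in> {t \<in> {0..<1}. residue k t = j} \<longleftrightarrow> t \<in> {real q / p k..<real (Suc q) / p k}"
      using iff[of t] sub by (cases "t \<in> {0..<1}") (simp, blast)
  qed
  have "measure unit_measure {real q / p k..<real (Suc q) / p k} = real (Suc q) / p k - real q / p k"
    using sub by (subst measure_restrict_space) (simp_all add: divide_right_mono)
  also have "\<dots> = 1 / real (p k)" by (simp add: diff_divide_distrib[symmetric])
  finally show ?thesis unfolding eq .
qed

lemma integral_residue:
  fixes a :: "nat \<Rightarrow> real"
  shows "(\<integral>t. a (residue k t) \<partial>unit_measure) = (\<Sum>j<p k. a j) / real (p k)"
proof -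
  interpret U: prob_space unit_measure by (rule prob_space_unit_measure)
  let ?S = "\<lambda>j. {t \<in> {0..<1::real}. residue k t = j}"
  have S: "?S j \<in> sets unit_measure" for j
  proof -
    have "residue k -` {j} \<inter> space unit_measure \<in> sets unit_measure"
      by (rule measurable_sets[OF measurable_residue]) simp
    moreover have "residue k -` {j} \<inter> space unit_measure = ?S j"
      by (simp add: set_eq_iff conj_commute)
    ultimately show ?thesis by (simp only:)
  qed
  have "(\<integral>t. a (residue k t) \<partial>unit_measure) = (\<integral>t. (\<Sum>j<p k. a j * indicator (?S j) t) \<partial>unit_measure)"
  proof (rule Bochner_Integration.integral_cong)
    fix t assume "t \<in> space unit_measure"
    then have t: "t \<in> {0..<1}" by simp
    have "(\<Sum>j<p k. a j * indicator (?S j) t) = (\<Sum>j<p k. if j = residue k t then a j else 0)"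
      using t by (intro sum.cong) (auto simp: indicator_def)
    then show "a (residue k t) = (\<Sum>j<p k. a j * indicator (?S j) t)"
      using residue_less[OF t] by simp
  qed simp
  also have "\<dots> = (\<Sum>j<p k. \<integral>t. a j * indicator (?S j) t \<partial>unit_measure)"
  proof (rule Bochner_Integration.integral_sum)
    show "integrable unit_measure (\<lambda>t. a j * indicator (?S j) t)" for j
      using S[of j] U.emeasure_finite[of "?S j"]
      by (intro integrable_mult_right integrable_real_indicator) (simp_all only: less_top infinity_ennreal_def)
  qed
  also have "\<dots> = (\<Sum>j<p k. a j * measure unit_measure (?S j))"
  proof (rule sum.cong)
    fix j
    have "?S j \<inter> space unit_measure = ?S j"
      by (rule Int_absorb2) (simp add: subset_eq)
    then show "(\<integral>t. a j * indicator (?S j) t \<partial>unit_measure) = a j * measure unit_measure (?S j)"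
      by (simp only: integral_mult_right_zero Bochner_Integration.integral_indicator)
  qed simp
  also have "\<dots> = (\<Sum>j<p k. a j * (1 / real (p k)))"
    by (intro sum.cong refl arg_cong2[where f = "(*)"] measure_residue_eq) simp
  finally show ?thesis by (simp add: sum_divide_distrib)
qed

lemma measure_residue:
  "measure unit_measure {t \<in> {0..<1}. P (residue k t)} = (\<Sum>j<p k. of_bool (P j)) / real (p k)"
proof -
  let ?S = "{t \<in> {0..<1::real}. P (residue k t)}"
  have "?S \<inter> space unit_measure = ?S"
    by (rule Int_absorb2) (simp add: subset_eq)
  then have "measure unit_measure ?S = (\<integral>t. indicator ?S t \<partial>unit_measure)"
    by (simp only: Bochner_Integration.integral_indicator)
  also have "\<dots> = (\<integral>t. of_bool (P (residue k t)) \<partial>unit_measure)"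
    by (intro Bochner_Integration.integral_cong) (auto simp: indicator_def)
  also have "\<dots> = (\<Sum>j<p k. of_bool (P j)) / real (p k)" by (rule integral_residue)
  finally show ?thesis .
qed

end


section \<open>The measure carried by a nested system of cyclic cells\<close>

text \<open>The interface between geometry and dynamics. \<open>N k j\<close> lists the cells along
  the cycle of level \<open>k\<close> periodically. Small diameters enter only as
  \<open>shrink\<close>, which is stated in terms of the topology: at a fixed point, all cells of
  late levels containing it fit into a given neighbourhood, uniformly in \<open>j\<close>.\<close>

locale cyclic_cells = odometer p for p :: "nat \<Rightarrow> nat" +
  fixes f :: "'a::topological_space \<Rightarrow> 'a" and N :: "nat \<Rightarrow> nat \<Rightarrow> 'a set"
  assumes compact: "compact (UNIV :: 'a set)"
    and homeo: "homeomorphism UNIV UNIV f (inv f)"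
    and closed: "closed (N k j)"
    and periodic: "N k (j + p k) = N k j"
    and nested: "N (Suc k) j \<subseteq> N k j"
    and meets: "f ` N k j \<inter> N k (Suc j) \<noteq> {}"
    and shrink: "\<lbrakk>open U; x \<in> U\<rbrakk> \<Longrightarrow> \<exists>k0. \<forall>k\<ge>k0. \<forall>j. x \<in> N k j \<longrightarrow> N k j \<subseteq> U"
begin

section \<open>Points determined by coherent sequences of cells\<close>

lemma N_mod: "N k (j mod p k) = N k j"
proof -
  have "N k (i + n * p k) = N k i" for i n
  proof (induction n)
    case (Suc n)
    have "N k (i + Suc n * p k) = N k ((i + n * p k) + p k)" by (simp add: algebra_simps)
    then show ?case using Suc periodic by simp
  qed simp
  from this[of "j mod p k" "j div p k"] show ?thesis by simp
qed

lemma N_cong: "i mod p k = j mod p k \<Longrightarrow> N k i = N k j"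
  using N_mod by metis

text \<open>A point of the inverse limit of the residues modulo \<open>p k\<close>, given by
  arbitrary natural representatives; adding \<open>d\<close>, or adding \<open>p k - 1\<close> in
  place of subtracting one, then needs no reduction.\<close>

definition coherent :: "(nat \<Rightarrow> nat) \<Rightarrow> bool" where
  "coherent r \<longleftrightarrow> (\<forall>k. r (Suc k) mod p k = r k mod p k)"

definition point_of :: "(nat \<Rightarrow> nat) \<Rightarrow> 'a \<Rightarrow> bool" where
  "point_of r x \<longleftrightarrow> (\<forall>k. x \<in> N k (r k))"

lemma coherent_decseq:
  assumes "coherent r"
  shows "decseq (\<lambda>k. N k (r k))"
proof (rule decseq_SucI)
  fix k
  have "N (Suc k) (r (Suc k)) \<subseteq> N k (r (Suc k))" by (rule nested)
  also have "\<dots> = N k (r k)" using assms by (intro N_cong) (simp add: coherent_def)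
  finally show "N (Suc k) (r (Suc k)) \<subseteq> N k (r k)" .
qed

lemma coherent_add: "coherent r \<Longrightarrow> coherent (\<lambda>k. r k + d)"
  unfolding coherent_def by (metis mod_add_left_eq)

text \<open>Nested nonempty closed sets in a compact space have a common point; the cells are
  nonempty because their images meet other cells.\<close>

lemma ex_point_of:
  assumes "coherent r"
  shows "\<exists>x. point_of r x"
proof -
  have ne: "N k j \<noteq> {}" for k j
    using meets[of k j] by auto
  have "UNIV \<inter> (\<Inter>k\<in>UNIV. N k (r k)) \<noteq> {}"
  proof (rule compact_imp_fip_image[OF compact])
    fix K :: "nat set" assume K: "finite K"
    show "UNIV \<inter> (\<Inter>k\<in>K. N k (r k)) \<noteq> {}"
    proof (cases "K = {}")
      case False
      have "N (Max K) (r (Max K)) \<subseteq> N k (r k)" if "k \<in> K" for k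
        using decseqD[OF coherent_decseq[OF assms] Max_ge[OF K that]] .
      then have "N (Max K) (r (Max K)) \<subseteq> UNIV \<inter> (\<Inter>k\<in>K. N k (r k))" by blast
      then show ?thesis using ne by blast
    qed simp
  qed (rule closed)
  then show ?thesis unfolding point_of_def by blast
qed

text \<open>Otherwise a whole cell around \<open>x\<close> would be mapped off some cell of the sequence \<open>r'\<close>.\<close>

lemma point_of_image:
  assumes "continuous_on UNIV h" "coherent r" "coherent r'" "point_of r x"
    and hit: "\<And>k. h ` N k (r k) \<inter> N k (r' k) \<noteq> {}"
  shows "point_of r' (h x)"
proof (rule ccontr)
  assume "\<not> point_of r' (h x)"
  then obtain k where k: "h x \<notin> N k (r' k)" unfolding point_of_def by blast
  let ?U = "h -` (- N k (r' k))"
  have "open ?U"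
    using assms(1) closed[of k "r' k"] by (intro open_vimage) auto
  then obtain k0 where k0: "\<forall>k\<ge>k0. \<forall>j. x \<in> N k j \<longrightarrow> N k j \<subseteq> ?U"
    using shrink[of ?U x] k by auto
  define n where "n = max k k0"
  have "N n (r n) \<subseteq> ?U" using k0 assms(4) by (simp add: n_def point_of_def)
  moreover have "N n (r' n) \<subseteq> N k (r' k)"
    using decseqD[OF coherent_decseq[OF assms(3)], of k n] by (simp add: n_def)
  ultimately show False using hit[of n] by blast
qed

lemma continuous_f: "continuous_on UNIV f" and continuous_inv_f: "continuous_on UNIV (inv f)"
  and inv_f_f: "inv f (f x) = x" and f_inv_f: "f (inv f x) = x"
  using homeo by (auto simp: homeomorphism_def)

lemma point_of_f:
  assumes "coherent r" "point_of r x"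
  shows "point_of (\<lambda>k. Suc (r k)) (f x)"
proof (rule point_of_image[OF continuous_f assms(1) _ assms(2) meets])
  show "coherent (\<lambda>k. Suc (r k))" using coherent_add[OF assms(1), of 1] by simp
qed

lemma point_of_funpow:
  assumes "coherent r" "point_of r x"
  shows "point_of (\<lambda>k. r k + d) ((f ^^ d) x)"
proof (induction d)
  case (Suc d)
  then show ?case using point_of_f[OF coherent_add[OF assms(1)]] by simp
qed (simp add: assms)

text \<open>The predecessor of \<open>r k\<close> is represented by \<open>r k + (p k - 1)\<close>.
  Applied there, \<open>meets\<close> says that \<open>inv f\<close> takes some point of the cell at
  \<open>r k\<close> into the cell at that index.\<close>

lemma point_of_inv_f:
  assumes r: "coherent r" "point_of r x"
  shows "point_of (\<lambda>k. r k + (p k - 1)) (inv f x)"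
proof (rule point_of_image[OF continuous_inv_f r(1) _ r(2)])
  have *: "Suc (r k + (p k - 1)) = r k + p k" for k using p_pos[of k] by simp
  show "coherent (\<lambda>k. r k + (p k - 1))"
    unfolding coherent_def
  proof
    fix k
    \<comment> \<open>This rearrangement avoids truncated subtraction across levels: the whole
      periods \<open>p k\<close> and \<open>p (Suc k)\<close> both vanish modulo
      \<open>p k\<close>.\<close>
    have "r (Suc k) + p (Suc k) + (p k - 1) = r (Suc k) + (p (Suc k) - 1) + p k"
      using p_pos[of k] p_pos[of "Suc k"] by simp
    moreover have "(r (Suc k) + p (Suc k) + (p k - 1)) mod p k = (r k + (p k - 1)) mod p k"
    proof -
      have "(r (Suc k) + p (Suc k)) mod p k = r k mod p k"
        using r(1) p_dvd[of k] unfolding coherent_def by (metis dvd_imp_mod_0 add.right_neutral mod_add_right_eq)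
      then show ?thesis by (rule mod_add_cong) simp
    qed
    ultimately show "(r (Suc k) + (p (Suc k) - 1)) mod p k = (r k + (p k - 1)) mod p k"
      by (metis mod_add_self2)
  qed
  fix k
  have "f ` N k (r k + (p k - 1)) \<inter> N k (r k) \<noteq> {}"
    using meets[of k "r k + (p k - 1)"] unfolding * periodic .
  then obtain y where "y \<in> N k (r k + (p k - 1))" "f y \<in> N k (r k)" by blast
  then have "inv f (f y) \<in> inv f ` N k (r k) \<inter> N k (r k + (p k - 1))"
    using inv_f_f[of y] by (metis IntI imageI)
  then show "inv f ` N k (r k) \<inter> N k (r k + (p k - 1)) \<noteq> {}" by blast
qed

section \<open>The coding map and its measurability\<close>

definition coding :: "real \<Rightarrow> 'a" where
  "coding t = (SOME x. point_of (\<lambda>k. residue k t) x)"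

lemma coherent_residue: "t \<in> {0..<1} \<Longrightarrow> coherent (\<lambda>k. residue k t)"
  unfolding coherent_def using residue_Suc_mod residue_less by simp

lemma point_of_coding: "t \<in> {0..<1} \<Longrightarrow> point_of (\<lambda>k. residue k t) (coding t)"
  unfolding coding_def by (rule someI_ex) (rule ex_point_of[OF coherent_residue])

text \<open>Membership in an open set is decided by a cell of finite level, whichever point the
  choice in \<open>coding\<close> returned. Preimages of open sets are therefore countable unions of
  sets depending on one residue, which makes \<open>coding\<close> measurable.\<close>

lemma coding_in_open_iff:
  assumes "open U" "t \<in> {0..<1}"
  shows "coding t \<in> U \<longleftrightarrow> (\<exists>k. N k (residue k t) \<subseteq> U)"
proof
  assume "coding t \<in> U"
  then obtain k where "\<forall>j. coding t \<in> N k j \<longrightarrow> N k j \<subseteq> U" using shrink[OF assms(1)] by blast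
  then show "\<exists>k. N k (residue k t) \<subseteq> U"
    using point_of_coding[OF assms(2)] unfolding point_of_def by blast
next
  assume "\<exists>k. N k (residue k t) \<subseteq> U"
  then show "coding t \<in> U"
    using point_of_coding[OF assms(2)] unfolding point_of_def by blast
qed

lemma sets_residue: "{t \<in> {0..<1}. P (residue k t)} \<in> sets unit_measure"
proof -
  have "residue k -` Collect P \<inter> space unit_measure \<in> sets unit_measure"
    by (rule measurable_sets[OF measurable_residue]) simp
  moreover have "residue k -` Collect P \<inter> space unit_measure = {t \<in> {0..<1}. P (residue k t)}"
    by (simp add: set_eq_iff conj_commute)
  ultimately show ?thesis by (simp only:)
qed

lemma coding_vimage_open:
  assumes "open U"
  shows "coding -` U \<inter> space unit_measure = (\<Union>k. {t \<in> {0..<1}. N k (residue k t) \<subseteq> U})"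
proof (rule set_eqI)
  fix t
  show "t \<in> coding -` U \<inter> space unit_measure \<longleftrightarrow> t \<in> (\<Union>k. {t \<in> {0..<1}. N k (residue k t) \<subseteq> U})"
    using coding_in_open_iff[OF assms, of t] by (cases "t \<in> {0..<1}") auto
qed

lemma measurable_coding [measurable]: "coding \<in> measurable unit_measure borel"
proof (rule borel_measurableI)
  fix U :: "'a set" assume "open U"
  then show "coding -` U \<inter> space unit_measure \<in> sets unit_measure"
    by (simp only: coding_vimage_open) (intro sets.countable_UN image_subsetI sets_residue)
qed

section \<open>The image measure and its invariance\<close>

definition cycle_measure :: "'a measure" where
  "cycle_measure = distr unit_measure borel coding"

lemma sets_cycle_measure [measurable_cong, simp]: "sets cycle_measure = sets borel"
  by (simp add: cycle_measure_def)

lemma space_cycle_measure [simp]: "space cycle_measure = UNIV"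
  by (simp add: cycle_measure_def)

lemma prob_space_cycle_measure: "prob_space cycle_measure"
  unfolding cycle_measure_def
  by (rule prob_space.prob_space_distr[OF prob_space_unit_measure measurable_coding])

sublocale \<mu>: prob_space cycle_measure
  by (rule prob_space_cycle_measure)

sublocale unit: prob_space unit_measure
  by (rule prob_space_unit_measure)

lemma measure_cycle_measure:
  "B \<in> sets borel \<Longrightarrow> measure cycle_measure B = measure unit_measure {t \<in> {0..<1}. coding t \<in> B}"
proof -
  assume B: "B \<in> sets borel"
  have "coding -` B \<inter> space unit_measure = {t \<in> {0..<1}. coding t \<in> B}"
    by (simp add: set_eq_iff conj_commute)
  then show ?thesis
    unfolding cycle_measure_def by (simp only: measure_distr[OF measurable_coding B])
qed

definition inner_count :: "nat \<Rightarrow> 'a set \<Rightarrow> real" where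
  "inner_count k U = (\<Sum>j<p k. of_bool (N k j \<subseteq> U))"

lemma inner_count_shift: "(\<Sum>j<p k. of_bool (N k (j + d) \<subseteq> U)) = inner_count k U"
  unfolding inner_count_def by (rule sum_shift_periodic) (simp add: periodic)

text \<open>By nesting, the parameters whose cell of level \<open>k\<close> lies in \<open>U\<close>
  form an increasing sequence of sets with union the preimage of \<open>U\<close>, so continuity
  from below applies.\<close>

lemma measure_open_LIMSEQ:
  assumes "open U"
  shows "(\<lambda>k. inner_count k U / real (p k)) \<longlonglongrightarrow> measure cycle_measure U"
proof -
  let ?A = "\<lambda>k. {t \<in> {0..<1}. N k (residue k t) \<subseteq> U}"
  have "incseq ?A"
  proof (rule incseq_SucI, rule subsetI)
    fix k t assume t: "t \<in> ?A k"
    have "N (Suc k) (residue (Suc k) t) \<subseteq> N k (residue k t)"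
      using decseqD[OF coherent_decseq[OF coherent_residue], of t k "Suc k"] t by simp
    then show "t \<in> ?A (Suc k)" using t by blast
  qed
  then have "(\<lambda>k. measure unit_measure (?A k)) \<longlonglongrightarrow> measure unit_measure (\<Union>k. ?A k)"
    by (intro unit.finite_Lim_measure_incseq image_subsetI sets_residue)
  moreover have "(\<Union>k. ?A k) = {t \<in> {0..<1}. coding t \<in> U}"
    unfolding coding_vimage_open[OF assms, symmetric] by (simp add: set_eq_iff conj_commute)
  moreover have "measure unit_measure (?A k) = inner_count k U / real (p k)" for k
    unfolding inner_count_def by (rule measure_residue[where P = "\<lambda>j. N k j \<subseteq> U"])
  ultimately show ?thesis
    by (simp only: measure_cycle_measure[OF borel_open[OF assms]])
qed

text \<open>Shifting residues by \<open>d k\<close> permutes the cells of the cycle and keeps the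
  inner count of \<open>U\<close>, while a shifted cell inside \<open>U\<close> certifies that
  \<open>h\<close> sends the coded point into \<open>U\<close>. Used with \<open>f\<close> and with
  \<open>inv f\<close>, the one-sided bound yields invariance.\<close>

lemma measure_le_vimage:
  assumes U: "open U" and h: "continuous_on UNIV h"
    and d: "\<And>t. t \<in> {0..<1} \<Longrightarrow> point_of (\<lambda>k. residue k t + d k) (h (coding t))"
  shows "measure cycle_measure U \<le> measure cycle_measure (h -` U)"
proof (rule LIMSEQ_le_const2[OF measure_open_LIMSEQ[OF U]], intro exI allI impI)
  fix k
  have V: "h -` U \<in> sets borel" by (rule borel_open[OF open_vimage[OF U h]])
  have "inner_count k U / real (p k) = measure unit_measure {t \<in> {0..<1}. N k (residue k t + d k) \<subseteq> U}"
    unfolding measure_residue[where P = "\<lambda>j. N k (j + d k) \<subseteq> U"] inner_count_shift ..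
  also have "\<dots> \<le> measure unit_measure {t \<in> {0..<1}. coding t \<in> h -` U}"
  proof (rule unit.finite_measure_mono)
    show "{t \<in> {0..<1}. N k (residue k t + d k) \<subseteq> U} \<subseteq> {t \<in> {0..<1}. coding t \<in> h -` U}"
      using d unfolding point_of_def by blast
    have "coding -` (h -` U) \<inter> space unit_measure = {t \<in> {0..<1}. coding t \<in> h -` U}"
      by (simp add: set_eq_iff conj_commute)
    then show "{t \<in> {0..<1}. coding t \<in> h -` U} \<in> sets unit_measure"
      using measurable_sets[OF measurable_coding V] by (simp only:)
  qed
  also have "\<dots> = measure cycle_measure (h -` U)" by (rule measure_cycle_measure[OF V, symmetric])
  finally show "inner_count k U / real (p k) \<le> measure cycle_measure (h -` U)" .
qed

lemma measure_vimage_open: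
  assumes "open U"
  shows "measure cycle_measure (f -` U) = measure cycle_measure U"
proof (rule antisym)
  have "measure cycle_measure (f -` U) \<le> measure cycle_measure (inv f -` (f -` U))"
    using open_vimage[OF assms continuous_f] continuous_inv_f
    by (rule measure_le_vimage) (rule point_of_inv_f[OF coherent_residue point_of_coding])
  then show "measure cycle_measure (f -` U) \<le> measure cycle_measure U"
    by (simp add: vimage_comp comp_def f_inv_f)
  show "measure cycle_measure U \<le> measure cycle_measure (f -` U)"
    using assms continuous_f
  proof (rule measure_le_vimage)
    show "point_of (\<lambda>k. residue k t + 1) (f (coding t))" if "t \<in> {0..<1}" for t
      using point_of_f[OF coherent_residue point_of_coding, OF that that] by simp
  qed
qed

lemma borel_f: "f \<in> borel_measurable borel" and borel_inv_f: "inv f \<in> borel_measurable borel"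
  using continuous_f continuous_inv_f by (auto intro: borel_measurable_continuous_onI)

lemma distr_f: "distr cycle_measure borel f = cycle_measure"
proof (rule borel_measure_eqI_open)
  have f: "f \<in> measurable cycle_measure borel" using borel_f by (simp cong: measurable_cong_sets)
  show "emeasure (distr cycle_measure borel f) UNIV \<noteq> \<infinity>"
    using f by (simp add: emeasure_distr)
  fix U :: "'a set" assume U: "open U"
  then have "emeasure (distr cycle_measure borel f) U = emeasure cycle_measure (f -` U)"
    using f by (simp add: emeasure_distr)
  then show "emeasure (distr cycle_measure borel f) U = emeasure cycle_measure U"
    using measure_vimage_open[OF U] by (simp add: \<mu>.emeasure_eq_measure)
qed simp_all

lemma emeasure_vimage_f:
  assumes "B \<in> sets borel"
  shows "emeasure cycle_measure (f -` B) = emeasure cycle_measure B"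
proof -
  have "emeasure cycle_measure B = emeasure (distr cycle_measure borel f) B" by (simp only: distr_f)
  also have "\<dots> = emeasure cycle_measure (f -` B \<inter> space cycle_measure)"
    using borel_f assms by (intro emeasure_distr) (simp_all cong: measurable_cong_sets)
  finally show ?thesis by simp
qed

lemma image_f_eq: "f ` B = inv f -` B"
  by (auto simp: inv_f_f) (metis f_inv_f imageI)

lemma invariant_cycle_measure: "invariant_measure f cycle_measure"
  unfolding invariant_measure_def
proof (intro conjI ballI)
  show "emeasure cycle_measure UNIV = 1" using \<mu>.emeasure_space_1 by simp
  fix B :: "'a set" assume B: "B \<in> sets borel"
  show "emeasure cycle_measure (f -` B) = emeasure cycle_measure B" by (rule emeasure_vimage_f[OF B])
  have "f ` B \<in> sets borel"
    unfolding image_f_eq using measurable_sets[OF borel_inv_f B] by simp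
  moreover have "f -` (f ` B) = B" by (simp add: image_f_eq set_eq_iff inv_f_f)
  ultimately show "emeasure cycle_measure (f ` B) = emeasure cycle_measure B"
    using emeasure_vimage_f by metis
qed simp

section \<open>Invariant sets and ergodicity\<close>

lemma integral_coding:
  fixes \<phi> :: "'a \<Rightarrow> real"
  assumes "\<phi> \<in> borel_measurable borel"
  shows "(\<integral>x. \<phi> x \<partial>cycle_measure) = (\<integral>t. \<phi> (coding t) \<partial>unit_measure)"
  unfolding cycle_measure_def by (rule integral_distr[OF measurable_coding assms])

lemma measure_coding:
  assumes "B \<in> sets borel"
  shows "measure cycle_measure B = (\<integral>t. indicator B (coding t) \<partial>unit_measure)"
proof -
  have "(\<integral>x. indicator B x \<partial>cycle_measure) = measure cycle_measure B" by simp
  then show ?thesis using integral_coding[of "indicator B"] assms by simp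
qed

lemma integrable_indicator_coding:
  assumes "B \<in> sets borel"
  shows "integrable unit_measure (\<lambda>t. indicator B (coding t) :: real)"
proof (rule unit.integrable_const_bound[where B = 1])
  have "(indicator B :: 'a \<Rightarrow> real) \<in> borel_measurable borel" using assms by simp
  from measurable_compose[OF measurable_coding this]
  show "(\<lambda>t. indicator B (coding t) :: real) \<in> borel_measurable unit_measure" .
qed (simp add: indicator_def)

lemma continuous_funpow: "continuous_on UNIV (f ^^ l)"
proof (induction l)
  case (Suc l)
  then show ?case using continuous_on_compose[OF Suc continuous_on_subset[OF continuous_f]]
    by (simp add: comp_def)
qed simp

text \<open>Since \<open>B\<close> is its own preimage, taking the preimage of the whole
  intersection only raises the exponent of \<open>f\<close> by one.\<close>

lemma measure_invariant_Int_vimage: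
  assumes "B \<in> sets borel" "f -` B = B" "open U"
  shows "measure cycle_measure (B \<inter> (f ^^ l) -` U) = measure cycle_measure (B \<inter> U)"
proof (induction l)
  case (Suc l)
  have "B \<inter> (f ^^ l) -` U \<in> sets borel"
    using assms(1) borel_open[OF open_vimage[OF assms(3) continuous_funpow]] by (rule sets.Int)
  then have "measure cycle_measure (f -` (B \<inter> (f ^^ l) -` U)) = measure cycle_measure (B \<inter> (f ^^ l) -` U)"
    using emeasure_vimage_f by (simp only: measure_def)
  moreover have "f -` (B \<inter> (f ^^ l) -` U) = B \<inter> (f ^^ Suc l) -` U"
    unfolding vimage_Int assms(2) by (simp add: vimage_def funpow_swap1)
  ultimately show ?case using Suc.IH by (simp only:)
qed simp

text \<open>Over \<open>p k\<close> consecutive steps the orbit of a coded point runs through all cells of level \<open>k\<close>, so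
  it visits \<open>U\<close> at least as often as there are cells inside \<open>U\<close>.\<close>

lemma measure_invariant_Int_open_ge:
  assumes B: "B \<in> sets borel" "f -` B = B" and U: "open U"
  shows "measure cycle_measure U * measure cycle_measure B \<le> measure cycle_measure (B \<inter> U)"
\<comment> \<open>The measure of \<open>U\<close> is the limit of the inner fractions, so a bound at
  each single level suffices.\<close>
proof (rule LIMSEQ_le_const2[OF tendsto_mult_right[OF measure_open_LIMSEQ[OF U]]], intro exI allI impI)
  fix k
  let ?V = "\<lambda>l. B \<inter> (f ^^ l) -` U"
  have V: "?V l \<in> sets borel" for l
    using B(1) borel_open[OF open_vimage[OF U continuous_funpow]] by (rule sets.Int)
  have "inner_count k U * measure cycle_measure B
      = (\<integral>t. inner_count k U * indicator B (coding t) \<partial>unit_measure)"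
    unfolding measure_coding[OF B(1)] by (rule integral_mult_right_zero[symmetric])
  also have "\<dots> \<le> (\<integral>t. (\<Sum>l<p k. indicator (?V l) (coding t)) \<partial>unit_measure)"
  proof (rule integral_mono)
    show "integrable unit_measure (\<lambda>t. inner_count k U * indicator B (coding t))"
      using integrable_indicator_coding[OF B(1)] by (rule integrable_mult_right)
    show "integrable unit_measure (\<lambda>t. \<Sum>l<p k. indicator (?V l) (coding t) :: real)"
      using integrable_indicator_coding[OF V] by (rule Bochner_Integration.integrable_sum)
    fix t assume "t \<in> space unit_measure"
    then have t: "t \<in> {0..<1}" by simp
    show "inner_count k U * indicator B (coding t) \<le> (\<Sum>l<p k. indicator (?V l) (coding t))"
    proof (cases "coding t \<in> B")
      case True
      \<comment> \<open>Starting the count at the cell of \<open>t\<close> makes \<open>l\<close>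
        the time along the orbit.\<close>
      have "inner_count k U = (\<Sum>l<p k. of_bool (N k (l + residue k t) \<subseteq> U))"
        by (rule inner_count_shift[symmetric])
      also have "\<dots> \<le> (\<Sum>l<p k. indicator (?V l) (coding t))"
      proof (rule sum_mono)
        fix l
        have "(f ^^ l) (coding t) \<in> N k (l + residue k t)"
          using point_of_funpow[OF coherent_residue point_of_coding, OF t t, of l]
          by (simp add: point_of_def add.commute)
        then show "of_bool (N k (l + residue k t) \<subseteq> U) \<le> (indicator (?V l) (coding t) :: real)"
          using True by (auto simp: indicator_def)
      qed
      finally show ?thesis using True by simp
    qed (simp add: sum_nonneg)
  qed
  also have "\<dots> = (\<Sum>l<p k. \<integral>t. indicator (?V l) (coding t) \<partial>unit_measure)"
    using integrable_indicator_coding[OF V] by (rule Bochner_Integration.integral_sum)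
  also have "\<dots> = (\<Sum>l<p k. measure cycle_measure (?V l))"
    by (simp only: measure_coding[OF V])
  \<comment> \<open>All \<open>p k\<close> terms are equal, which cancels the denominator of the
    inner fraction.\<close>
  also have "\<dots> = real (p k) * measure cycle_measure (B \<inter> U)"
    by (simp add: measure_invariant_Int_vimage[OF B U])
  finally show "inner_count k U / real (p k) * measure cycle_measure B \<le> measure cycle_measure (B \<inter> U)"
    using p_pos[of k] by (simp add: field_simps)
qed

lemma measure_invariant_Int_open:
  assumes B: "B \<in> sets borel" "f -` B = B" and U: "open U"
  shows "measure cycle_measure (B \<inter> U) = measure cycle_measure B * measure cycle_measure U"
proof (rule antisym)
  have C: "- B \<in> sets borel" "f -` (- B) = - B" using B by (auto simp: vimage_Compl)
  have "measure cycle_measure U * measure cycle_measure (- B) \<le> measure cycle_measure (- B \<inter> U)"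
    by (rule measure_invariant_Int_open_ge[OF C U])
  moreover have "measure cycle_measure (- B) = 1 - measure cycle_measure B"
    using \<mu>.prob_compl[of B] B(1) by (simp add: Compl_eq_Diff_UNIV)
  moreover have "measure cycle_measure U = measure cycle_measure (B \<inter> U) + measure cycle_measure (- B \<inter> U)"
  proof -
    have "measure cycle_measure ((B \<inter> U) \<union> (- B \<inter> U)) = measure cycle_measure (B \<inter> U) + measure cycle_measure (- B \<inter> U)"
      using B C U by (intro \<mu>.finite_measure_Union) auto
    moreover have "(B \<inter> U) \<union> (- B \<inter> U) = U" by blast
    ultimately show ?thesis by simp
  qed
  ultimately show "measure cycle_measure (B \<inter> U) \<le> measure cycle_measure B * measure cycle_measure U"
    by (simp add: algebra_simps)
  show "measure cycle_measure B * measure cycle_measure U \<le> measure cycle_measure (B \<inter> U)"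
    using measure_invariant_Int_open_ge[OF B U] by (simp add: mult.commute)
qed

lemma ergodic_cycle_measure: "ergodic_measure f cycle_measure"
  unfolding ergodic_measure_def
proof (intro conjI ballI impI invariant_cycle_measure)
  fix B :: "'a set" assume B: "B \<in> sets borel" "f -` B = B"
  let ?b = "measure cycle_measure B"
  \<comment> \<open>The product formula is known for open sets. Read as an equality of two finite
    measures it extends to Borel sets, and can then be evaluated at \<open>B\<close> itself.\<close>
  have "density cycle_measure (indicator B) = density cycle_measure (\<lambda>_. ennreal ?b)"
  proof (rule borel_measure_eqI_open)
    show "emeasure (density cycle_measure (indicator B)) UNIV \<noteq> \<infinity>"
      using B(1) by (simp add: emeasure_restricted)
    fix U :: "'a set" assume U: "open U"
    then show "emeasure (density cycle_measure (indicator B)) U = emeasure (density cycle_measure (\<lambda>_. ennreal ?b)) U"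
      using B(1) measure_invariant_Int_open[OF B U]
      by (simp add: emeasure_restricted emeasure_density_const \<mu>.emeasure_eq_measure ennreal_mult)
  qed simp_all
  then have "emeasure (density cycle_measure (indicator B)) B = emeasure (density cycle_measure (\<lambda>_. ennreal ?b)) B"
    by (simp only:)
  then have "?b = ?b * ?b"
    using B(1) by (simp add: emeasure_restricted emeasure_density_const \<mu>.emeasure_eq_measure ennreal_mult[symmetric])
  then have "?b = 0 \<or> ?b = 1" by simp
  moreover have "measure cycle_measure (- B) = 1 - ?b"
    using \<mu>.prob_compl[of B] B(1) by (simp add: Compl_eq_Diff_UNIV)
  ultimately show "emeasure cycle_measure B = 0 \<or> emeasure cycle_measure (- B) = 0"
    by (auto simp: \<mu>.emeasure_eq_measure)
qed

text \<open>\<open>a k j\<close> stands for an average of \<open>\<phi>\<close> over a cell, known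
  only through the property that it inherits every error bound valid on the whole cell. Along the
  labels of \<open>t\<close> it converges to the value at the coded point, by
  \<open>shrink\<close>.\<close>

lemma averages_LIMSEQ:
  fixes \<phi> :: "'a \<Rightarrow> real"
  assumes \<phi>: "continuous_on UNIV \<phi>"
    and a: "\<And>k j c e. (\<And>y. y \<in> N k j \<Longrightarrow> \<bar>\<phi> y - c\<bar> \<le> e) \<Longrightarrow> \<bar>a k j - c\<bar> \<le> e"
  shows "(\<lambda>k. (\<Sum>j<p k. a k j) / real (p k)) \<longlonglongrightarrow> (\<integral>x. \<phi> x \<partial>cycle_measure)"
proof -
  have "bounded (\<phi> ` UNIV)" using compact_continuous_image[OF \<phi> compact] by (rule compact_imp_bounded)
  then obtain K where K: "\<And>x. \<bar>\<phi> x\<bar> \<le> K" by (auto simp: bounded_iff)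
  have \<phi>_meas: "\<phi> \<in> borel_measurable borel" using \<phi> by (rule borel_measurable_continuous_onI)
  have "(\<lambda>k. \<integral>t. a k (residue k t) \<partial>unit_measure) \<longlonglongrightarrow> (\<integral>t. \<phi> (coding t) \<partial>unit_measure)"
  proof (rule integral_dominated_convergence[where w = "\<lambda>_. K"])
    show "(\<lambda>t. \<phi> (coding t)) \<in> borel_measurable unit_measure"
      by (rule measurable_compose[OF measurable_coding \<phi>_meas])
    show "(\<lambda>t. a k (residue k t)) \<in> borel_measurable unit_measure" for k
      by (rule measurable_compose[OF measurable_residue]) simp
    \<comment> \<open>Comparison with the constant 0 turns the bound for \<open>\<phi>\<close> into
      one for its averages.\<close>
    show "AE t in unit_measure. norm (a k (residue k t)) \<le> K" for k
      using a[of k _ 0 K] K by simp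
    show "AE t in unit_measure. (\<lambda>k. a k (residue k t)) \<longlonglongrightarrow> \<phi> (coding t)"
    proof (rule AE_I2)
      fix t assume "t \<in> space unit_measure"
      then have t: "t \<in> {0..<1}" by simp
      show "(\<lambda>k. a k (residue k t)) \<longlonglongrightarrow> \<phi> (coding t)"
      proof (rule LIMSEQ_I)
        fix e :: real assume "0 < e"
        \<comment> \<open>Averaging preserves non-strict bounds; the radius \<open>e / 2\<close>
          leaves room for the strict inequality below.\<close>
        let ?U = "\<phi> -` ball (\<phi> (coding t)) (e / 2)"
        have "open ?U" using open_ball \<phi> by (rule open_vimage)
        moreover have "coding t \<in> ?U" using \<open>0 < e\<close> by simp
        ultimately obtain k0 where k0: "\<forall>k\<ge>k0. \<forall>j. coding t \<in> N k j \<longrightarrow> N k j \<subseteq> ?U"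
          using shrink by blast
        have "\<bar>a k (residue k t) - \<phi> (coding t)\<bar> \<le> e / 2" if "k0 \<le> k" for k
        proof (rule a)
          fix y assume "y \<in> N k (residue k t)"
          moreover have "N k (residue k t) \<subseteq> ?U"
            using k0 that point_of_coding[OF t] by (simp add: point_of_def)
          ultimately show "\<bar>\<phi> y - \<phi> (coding t)\<bar> \<le> e / 2"
            by (auto simp: dist_real_def abs_minus_commute subset_eq)
        qed
        then show "\<exists>k0. \<forall>k\<ge>k0. norm (a k (residue k t) - \<phi> (coding t)) < e"
          using \<open>0 < e\<close> by (intro exI[of _ k0]) fastforce
      qed
    qed
  qed simp
  then show ?thesis by (simp only: integral_residue integral_coding[OF \<phi>_meas])
qed

end


section \<open>Riemannian distance and volume\<close>

text \<open>About the integrand \<open>u\<close> only a pointwise lower bound is known. It is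
  replaced by the measurable minorant \<open>P\<close>, the positive part of the derivative in the
  direction of the displacement, whose integral dominates the displacement.\<close>

lemma norm_displacement_le_nn_integral:
  fixes \<eta> :: "real \<Rightarrow> 'e::euclidean_space"
  assumes "a \<le> b" "finite S" and cont: "continuous_on {a..b} \<eta>"
    and deriv: "\<And>t. t \<in> {a..b} - S \<Longrightarrow> (\<eta> has_vector_derivative D t) (at t)"
    and D: "continuous_on ({a..b} - S) D"
    and le: "\<And>t. t \<in> {a..b} - S \<Longrightarrow> norm (D t) \<le> u t"
  shows "ennreal (norm (\<eta> b - \<eta> a)) \<le> (\<integral>\<^sup>+t\<in>{a..b}. ennreal (u t) \<partial>lborel)"
proof (cases "(\<integral>\<^sup>+t\<in>{a..b}. ennreal (u t) \<partial>lborel) = \<infinity>")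
  case False
  define e where "e = sgn (\<eta> b - \<eta> a)"
  define P where "P t = indicator ({a..b} - S) t * max 0 (D t \<bullet> e)" for t
  have "closed S" using \<open>finite S\<close> by (rule finite_imp_closed)
  then have "{a..b} - S \<in> sets borel" by (intro sets.Diff) auto
  then have P_meas: "P \<in> borel_measurable borel"
    using borel_measurable_continuous_on_indicator[of "{a..b} - S" "\<lambda>t. max 0 (D t \<bullet> e)"] D
    by (simp add: P_def[abs_def] continuous_on_max continuous_on_inner)
  have "norm e \<le> 1" by (simp add: e_def norm_sgn)
  have P_le: "ennreal (P t) \<le> ennreal (u t) * indicator {a..b} t" for t
  proof (cases "t \<in> {a..b} - S")
    case True
    have "D t \<bullet> e \<le> norm (D t) * norm e" by (rule norm_cauchy_schwarz)
    also have "\<dots> \<le> norm (D t)" using \<open>norm e \<le> 1\<close> by (simp add: mult_left_le)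
    also have "\<dots> \<le> u t" using True by (rule le)
    finally have "max 0 (D t \<bullet> e) \<le> u t" using order_trans[OF norm_ge_zero le[OF True]] by simp
    then show ?thesis using True by (simp add: P_def ennreal_leI)
  qed (simp add: P_def)
  have nn: "(\<integral>\<^sup>+t. ennreal (P t) \<partial>lborel) \<le> (\<integral>\<^sup>+t\<in>{a..b}. ennreal (u t) \<partial>lborel)"
    using P_le by (intro nn_integral_mono)
  also have "\<dots> < \<infinity>" using False by (simp add: less_top)
  finally have P_int: "integrable lborel P"
    using P_meas by (intro integrableI_nonneg) (auto simp: P_def)
  have "(P has_integral integral\<^sup>L lborel P) UNIV"
    using P_int by (rule has_integral_integral_lborel)
  moreover have "P = (\<lambda>t. if t \<in> {a..b} then P t else 0)" unfolding P_def by (rule ext) (auto simp: indicator_def)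
  ultimately have P_has: "(P has_integral integral\<^sup>L lborel P) {a..b}"
    using has_integral_restrict_UNIV[of "{a..b}" P] by simp
  \<comment> \<open>The value 0 on \<open>S\<close> makes the projection of \<open>D'\<close> on
    \<open>e\<close> lie below \<open>P\<close> on the whole interval; the fundamental theorem of
    calculus tolerates the finite set \<open>S\<close>.\<close>
  define D' where "D' t = (if t \<in> {a..b} - S then D t else 0)" for t
  have "(D' has_integral (\<eta> b - \<eta> a)) {a..b}"
    using \<open>finite S\<close> \<open>a \<le> b\<close> _ cont
    by (rule fundamental_theorem_of_calculus_strong) (simp add: D'_def deriv)
  from has_integral_linear[OF this bounded_linear_inner_left[of e]]
  have "((\<lambda>t. D' t \<bullet> e) has_integral ((\<eta> b - \<eta> a) \<bullet> e)) {a..b}" by (simp add: comp_def)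
  then have "(\<eta> b - \<eta> a) \<bullet> e \<le> integral\<^sup>L lborel P"
    by (rule has_integral_le[OF _ P_has]) (simp add: D'_def P_def)
  moreover have "(\<eta> b - \<eta> a) \<bullet> e = norm (\<eta> b - \<eta> a)"
    by (cases "\<eta> b = \<eta> a") (simp_all add: e_def sgn_div_norm dot_square_norm power2_eq_square)
  ultimately have "ennreal (norm (\<eta> b - \<eta> a)) \<le> ennreal (integral\<^sup>L lborel P)"
    by (simp add: ennreal_leI)
  also have "\<dots> = (\<integral>\<^sup>+t. ennreal (P t) \<partial>lborel)"
    using P_int by (intro nn_integral_eq_integral[symmetric]) (auto simp: P_def)
  finally show ?thesis using nn by (rule order_trans)
qed simp

lemma continuous_on_matrix_vector_mult:
  fixes A :: "'x::topological_space \<Rightarrow> real ^ 'm ^ 'n"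
  assumes "continuous_on S A" "continuous_on S u"
  shows "continuous_on S (\<lambda>x. A x *v u x)"
  unfolding matrix_vector_mult_def
  by (intro continuous_on_vec_lambda continuous_on_sum continuous_on_mult continuous_on_component assms)

text \<open>The quadratic form attains a positive minimum on the product of \<open>S\<close> with
  the unit sphere, and homogeneity extends the bound to all vectors; \<open>l\<close> is the square
  root of the minimum. For empty \<open>S\<close> any positive \<open>l\<close> will do.\<close>

lemma positive_definite_lower_bound:
  fixes A :: "'x::topological_space \<Rightarrow> real ^ 'n::finite ^ 'n"
  assumes "compact S" "continuous_on S A"
    and pos: "\<And>x u. x \<in> S \<Longrightarrow> u \<noteq> 0 \<Longrightarrow> 0 < u \<bullet> (A x *v u)"
  obtains l where "0 < l" "\<And>x u. x \<in> S \<Longrightarrow> l * norm u \<le> sqrt (u \<bullet> (A x *v u))"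
proof (cases "S = {}")
  case False
  let ?T = "S \<times> sphere (0 :: real ^ 'n) 1" and ?q = "\<lambda>z. snd z \<bullet> (A (fst z) *v snd z)"
  have "compact ?T" using assms(1) by (intro compact_Times compact_sphere)
  moreover have "?T \<noteq> {}" using False by simp
  moreover have "continuous_on ?T ?q"
    by (intro continuous_on_inner continuous_on_matrix_vector_mult continuous_on_compose2[OF assms(2)])
      (auto intro: continuous_intros)
  ultimately have "\<exists>z\<in>?T. \<forall>y\<in>?T. ?q z \<le> ?q y" by (rule continuous_attains_inf)
  then obtain z where z: "z \<in> ?T" "\<And>y. y \<in> ?T \<Longrightarrow> ?q z \<le> ?q y" by blast
  have "0 < ?q z" using z(1) by (intro pos) auto
  have "sqrt (?q z) * norm u \<le> sqrt (u \<bullet> (A x *v u))" if "x \<in> S" for x u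
  proof (cases "u = 0")
    case u: False
    define w where "w = u /\<^sub>R norm u"
    have "u = norm u *\<^sub>R w" using u by (simp add: w_def)
    then have "u \<bullet> (A x *v u) = norm u * (norm u * (w \<bullet> (A x *v w)))"
      by (metis inner_scaleR_left inner_scaleR_right matrix_vector_mult_scaleR)
    moreover have "?q z \<le> w \<bullet> (A x *v w)"
      using z(2)[of "(x, w)"] that u by (simp add: w_def)
    then have "(norm u * norm u) * ?q z \<le> (norm u * norm u) * (w \<bullet> (A x *v w))"
      by (rule mult_left_mono) simp
    ultimately have "(norm u)\<^sup>2 * ?q z \<le> u \<bullet> (A x *v u)"
      by (simp only: power2_eq_square mult.assoc)
    then have "sqrt ((norm u)\<^sup>2 * ?q z) \<le> sqrt (u \<bullet> (A x *v u))" by (rule real_sqrt_le_mono)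
    then show ?thesis by (simp add: real_sqrt_mult mult.commute)
  qed simp
  then show thesis using that[of "sqrt (?q z)"] \<open>0 < ?q z\<close> by simp
qed (use that[of 1] in auto)

section \<open>Charts, speed, distance and volume\<close>

context
  fixes \<A> :: "('a::{t2_space,second_countable_topology}, 'n::finite) chart set"
    and g :: "('a, 'n) chart \<Rightarrow> 'a \<Rightarrow> real ^ 'n ^ 'n"
  assumes atlas: "smooth_atlas \<A>" and metric: "riemannian_metric \<A> g"
begin

lemma chart_open: "c \<in> \<A> \<Longrightarrow> open (fst c)" "c \<in> \<A> \<Longrightarrow> open (snd c ` fst c)"
  and chart_homeomorphism: "c \<in> \<A> \<Longrightarrow> homeomorphism (fst c) (snd c ` fst c) (snd c) (chart_inv c)"
  and ex_chart: "\<exists>c\<in>\<A>. x \<in> fst c"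
  using atlas unfolding smooth_atlas_def by blast+

lemma chart_inv_chart: "c \<in> \<A> \<Longrightarrow> x \<in> fst c \<Longrightarrow> chart_inv c (snd c x) = x"
  using homeomorphism_apply1[OF chart_homeomorphism] .

lemma continuous_on_metric:
  assumes "c \<in> \<A>"
  shows "continuous_on (snd c ` fst c) (\<lambda>y. g c (chart_inv c y))"
proof -
  have "smooth_on (\<lambda>y. g c (chart_inv c y)) (snd c ` fst c)"
    using metric assms unfolding riemannian_metric_def by blast
  then have "ck_on 0 (\<lambda>y. g c (chart_inv c y)) (snd c ` fst c)" unfolding smooth_on_def by blast
  then show ?thesis by simp
qed

lemma chart_change_differentiable:
  assumes "c \<in> \<A>" "d \<in> \<A>" "x \<in> fst c \<inter> fst d"
  shows "(snd d \<circ> chart_inv c) differentiable (at (snd c x))"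
proof -
  have "smooth_on (snd d \<circ> chart_inv c) (snd c ` (fst c \<inter> fst d))"
    using atlas assms unfolding smooth_atlas_def by blast
  then have "ck_on (Suc 0) (snd d \<circ> chart_inv c) (snd c ` (fst c \<inter> fst d))" unfolding smooth_on_def by blast
  then show ?thesis using assms(3) by simp
qed

lemma metric_change:
  assumes "c \<in> \<A>" "d \<in> \<A>" "x \<in> fst c \<inter> fst d"
  shows "u \<bullet> (g c x *v u) =
    frechet_derivative (snd d \<circ> chart_inv c) (at (snd c x)) u \<bullet>
      (g d x *v frechet_derivative (snd d \<circ> chart_inv c) (at (snd c x)) u)"
proof -
  let ?D = "frechet_derivative (snd d \<circ> chart_inv c) (at (snd c x))"
  let ?J = "matrix ?D"
  have "g c x = transpose ?J ** g d x ** ?J"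
    using metric assms unfolding riemannian_metric_def Let_def by blast
  then have "u \<bullet> (g c x *v u) = u \<bullet> (transpose ?J *v (g d x *v (?J *v u)))"
    by (simp only: matrix_vector_mul_assoc matrix_mul_assoc)
  also have "\<dots> = (?J *v u) \<bullet> (g d x *v (?J *v u))"
    unfolding transpose_matrix_vector by (subst inner_commute, subst dot_lmul_matrix, rule inner_commute)
  finally have *: "u \<bullet> (g c x *v u) = (?J *v u) \<bullet> (g d x *v (?J *v u))" .
  have "bounded_linear ?D"
    using chart_change_differentiable[OF assms] unfolding frechet_derivative_works
    by (rule has_derivative_bounded_linear)
  then have "?J *v u = ?D u" by (rule matrix_vector_mul(3)[THEN fun_cong])
  then show ?thesis using * by simp
qed

text \<open>\<open>speed\<close> uses a chart picked by choice. By continuity the curve stays in the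
  domain of \<open>c\<close> near \<open>t\<close>, so its expression in the chosen chart is the
  transition map after the one in \<open>c\<close>; the chain rule changes the derivative and
  \<open>metric_change\<close> compensates.\<close>

lemma speed_in_chart:
  assumes c: "c \<in> \<A>" "\<gamma> t \<in> fst c" and cont: "isCont \<gamma> t"
    and deriv: "((snd c \<circ> \<gamma>) has_vector_derivative u) (at t)"
  shows "speed \<A> g \<gamma> t = sqrt (u \<bullet> (g c (\<gamma> t) *v u))"
proof -
  define d where "d = (SOME d. d \<in> \<A> \<and> \<gamma> t \<in> fst d)"
  have "\<exists>d. d \<in> \<A> \<and> \<gamma> t \<in> fst d" using ex_chart by blast
  then have d: "d \<in> \<A>" "\<gamma> t \<in> fst d" unfolding d_def by (rule someI_ex[THEN conjunct1], rule someI_ex[THEN conjunct2])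
  let ?F = "snd d \<circ> chart_inv c"
  let ?D = "frechet_derivative ?F (at (snd c (\<gamma> t)))"
  have x: "\<gamma> t \<in> fst c \<inter> fst d" using c d by simp
  have F: "(?F has_derivative ?D) (at ((snd c \<circ> \<gamma>) t))"
    using chart_change_differentiable[OF c(1) d(1) x] unfolding frechet_derivative_works comp_apply .
  then interpret D: bounded_linear ?D by (rule has_derivative_bounded_linear)
  have "((\<lambda>s. ?F ((snd c \<circ> \<gamma>) s)) has_derivative (\<lambda>s. ?D (s *\<^sub>R u))) (at t)"
    using deriv F unfolding has_vector_derivative_def
    by (rule has_derivative_compose[where f = "snd c \<circ> \<gamma>" and g = ?F])
  then have comp: "((\<lambda>s. ?F ((snd c \<circ> \<gamma>) s)) has_vector_derivative ?D u) (at t)"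
    unfolding has_vector_derivative_def D.scaleR .
  have "eventually (\<lambda>s. \<gamma> s \<in> fst c) (nhds t)"
  proof -
    have "(\<gamma> \<longlongrightarrow> \<gamma> t) (at t)" using cont by (simp add: isCont_def)
    then have "eventually (\<lambda>s. \<gamma> s \<in> fst c) (at t)"
      by (rule topological_tendstoD) (use c chart_open in auto)
    then show ?thesis using c(2) by (simp add: eventually_nhds_conv_at)
  qed
  then have "\<exists>T. open T \<and> t \<in> T \<and> (\<forall>s\<in>T. \<gamma> s \<in> fst c)" unfolding eventually_nhds .
  then obtain T where T: "open T" "t \<in> T" "\<And>s. s \<in> T \<Longrightarrow> \<gamma> s \<in> fst c" by blast
  have "((snd d \<circ> \<gamma>) has_vector_derivative ?D u) (at t)"
    using comp T(1,2)
    by (rule has_vector_derivative_transform_within_open) (simp add: chart_inv_chart[OF c(1) T(3)])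
  then have "vector_derivative (snd d \<circ> \<gamma>) (at t) = ?D u" by (rule vector_derivative_at)
  then show ?thesis
    unfolding speed_def d_def[symmetric] Let_def metric_change[OF c(1) d(1) x] by simp
qed

text \<open>A curve from \<open>x\<close> to a point outside \<open>U\<close> must leave a
  coordinate ball of radius \<open>r\<close>. Until its first exit its speed is at least
  \<open>l\<close> times the Euclidean one, so its length is at least \<open>l * r\<close>.\<close>

lemma riemannian_ball_subset_open:
  assumes "open U" "x \<in> U"
  obtains l :: real where "0 < l" "\<And>z. riemannian_dist \<A> g x z < ennreal l \<Longrightarrow> z \<in> U"
proof -
  obtain c where c: "c \<in> \<A>" "x \<in> fst c" using ex_chart by blast
  let ?\<phi> = "snd c" and ?\<psi> = "chart_inv c"
  have hom: "homeomorphism (fst c) (?\<phi> ` fst c) ?\<phi> ?\<psi>" by (rule chart_homeomorphism[OF c(1)])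
  have op: "open (fst c)" "open (?\<phi> ` fst c)" using chart_open[OF c(1)] by auto
  have "open (?\<phi> ` fst c \<inter> ?\<psi> -` U)"
    using homeomorphism_cont2[OF hom] op(2) assms(1) by (rule continuous_open_preimage)
  moreover have "?\<phi> x \<in> ?\<phi> ` fst c \<inter> ?\<psi> -` U" using c assms(2) by (simp add: chart_inv_chart)
  ultimately obtain r where r: "0 < r" "cball (?\<phi> x) r \<subseteq> ?\<phi> ` fst c \<inter> ?\<psi> -` U"
    by (meson open_contains_cball)
  let ?B = "cball (?\<phi> x) r"
  obtain l where l: "0 < l" "\<And>y u. y \<in> ?B \<Longrightarrow> l * norm u \<le> sqrt (u \<bullet> (g c (?\<psi> y) *v u))"
  proof (rule positive_definite_lower_bound[of ?B "\<lambda>y. g c (?\<psi> y)"])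
    show "continuous_on ?B (\<lambda>y. g c (?\<psi> y))"
      using continuous_on_metric[OF c(1)] by (rule continuous_on_subset) (use r in blast)
    fix y u assume y: "y \<in> ?B" and u: "(u :: real ^ 'n) \<noteq> 0"
    have "y \<in> ?\<phi> ` fst c" using y r by blast
    then have "?\<psi> y \<in> fst c" using homeomorphism_image2[OF hom] by blast
    then show "0 < u \<bullet> (g c (?\<psi> y) *v u)"
      using metric c(1) u unfolding riemannian_metric_def by blast
  qed auto
  define W where "W = fst c \<inter> ?\<phi> -` ball (?\<phi> x) r"
  have W: "open W"
    unfolding W_def using homeomorphism_cont1[OF hom] op(1) open_ball by (rule continuous_open_preimage)
  have "x \<in> W" using c r by (simp add: W_def)
  have "W \<subseteq> U"
  proof
    fix y assume "y \<in> W"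
    then have "?\<phi> y \<in> ?B" "y \<in> fst c" by (auto simp: W_def)
    then have "?\<psi> (?\<phi> y) \<in> U" using r by blast
    then show "y \<in> U" using chart_inv_chart[OF c(1) \<open>y \<in> fst c\<close>] by simp
  qed
  \<comment> \<open>At the exit time the curve has left the open set \<open>W\<close> but must still
    be in the chart. \<open>K\<close> is compact, hence closed, so it contains this limit point as
    well.\<close>
  define K where "K = ?\<psi> ` ?B"
  have "continuous_on ?B ?\<psi>"
    using homeomorphism_cont2[OF hom] by (rule continuous_on_subset) (use r in blast)
  then have "compact K" unfolding K_def using compact_cball by (rule compact_continuous_image)
  then have "closed K" by (rule compact_imp_closed)
  have "W \<subseteq> K"
  proof
    fix y assume y: "y \<in> W"
    then have "?\<phi> y \<in> ?B" by (auto simp: W_def)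
    moreover have "y = ?\<psi> (?\<phi> y)" using y chart_inv_chart[OF c(1)] by (simp add: W_def)
    ultimately show "y \<in> K" unfolding K_def by (rule rev_image_eqI)
  qed
  have K: "y \<in> fst c" "?\<phi> y \<in> ?B" if y: "y \<in> K" for y
  proof -
    obtain w where w: "w \<in> ?B" "y = ?\<psi> w" using y unfolding K_def by blast
    have "w \<in> ?\<phi> ` fst c" using w r by blast
    then show "y \<in> fst c" "?\<phi> y \<in> ?B"
      using w homeomorphism_image2[OF hom] homeomorphism_apply2[OF hom] by auto
  qed
  have "ennreal (l * r) \<le> curve_length \<A> g \<gamma>"
    if \<gamma>: "piecewise_C1_curve \<A> \<gamma>" "pathstart \<gamma> = x" "pathfinish \<gamma> \<notin> U" for \<gamma>
  proof -
    have cont: "continuous_on {0..1} \<gamma>" using \<gamma>(1) by (simp add: piecewise_C1_curve_def path_def)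
    let ?E = "{0..1} \<inter> \<gamma> -` (- W)"
    have "closed ?E" using cont closed_atLeastAtMost W by (intro continuous_closed_preimage) auto
    then have "compact ?E"
      unfolding compact_eq_bounded_closed using bounded_subset[OF bounded_closed_interval, of ?E 0 1] by simp
    moreover have "1 \<in> ?E" using \<gamma>(3) \<open>W \<subseteq> U\<close> by (auto simp: pathfinish_def)
    ultimately obtain b where b: "b \<in> ?E" "\<And>t. t \<in> ?E \<Longrightarrow> b \<le> t"
      using compact_attains_inf[of ?E] by (metis empty_iff)
    have "\<gamma> 0 \<in> W" using \<gamma>(2) \<open>x \<in> W\<close> by (simp add: pathstart_def)
    then have b0: "0 < b" "b \<le> 1" using b(1) by (cases "b = 0"; auto)+
    have inW: "\<gamma> t \<in> W" if "t \<in> {0..<b}" for t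
      using b(2)[of t] that b0 by (cases "\<gamma> t \<in> W") auto
    have "closure {0..<b} \<subseteq> {0..1} \<inter> \<gamma> -` K"
    proof (rule closure_minimal)
      show "closed ({0..1} \<inter> \<gamma> -` K)"
        using cont closed_atLeastAtMost \<open>closed K\<close> by (rule continuous_closed_preimage)
      show "{0..<b} \<subseteq> {0..1} \<inter> \<gamma> -` K"
        using b0 by (auto intro!: subsetD[OF \<open>W \<subseteq> K\<close>] inW)
    qed
    then have inK: "\<gamma> t \<in> K" if "t \<in> {0..b}" for t
      using that b0 by (auto simp: closure_atLeastLessThan)
    have "\<gamma> ` {0..b} \<subseteq> fst c" using inK K(1) by blast
    then have "0 \<le> (0 :: real) \<and> 0 \<le> b \<and> b \<le> 1 \<and> \<gamma> ` {0..b} \<subseteq> fst c" using b0 by simp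
    then have "(?\<phi> \<circ> \<gamma>) piecewise_C1_differentiable_on {0..b}"
      by (rule \<gamma>(1)[unfolded piecewise_C1_curve_def, THEN conjunct2, THEN bspec, OF c(1),
          THEN spec, THEN spec, THEN mp])
    then have cont\<eta>: "continuous_on {0..b} (?\<phi> \<circ> \<gamma>)"
      and "\<exists>S. finite S \<and> (\<exists>D. (\<forall>t\<in>{0..b} - S. ((?\<phi> \<circ> \<gamma>) has_vector_derivative D t) (at t)) \<and>
        continuous_on ({0..b} - S) D)"
      unfolding piecewise_C1_differentiable_on_def C1_differentiable_on_def by simp_all
    then obtain S D where S: "finite S"
      and deriv: "\<And>t. t \<in> {0..b} - S \<Longrightarrow> ((?\<phi> \<circ> \<gamma>) has_vector_derivative D t) (at t)"
      and D: "continuous_on ({0..b} - S) D"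
      by blast
    \<comment> \<open>Away from 0 and \<open>b\<close>, every \<open>t\<close> is interior to the
      unit interval, so continuity on the interval gives continuity at \<open>t\<close>, as
      \<open>speed_in_chart\<close> requires.\<close>
    let ?S = "S \<union> {0, b}"
    have "ennreal (norm (l *\<^sub>R (?\<phi> \<circ> \<gamma>) b - l *\<^sub>R (?\<phi> \<circ> \<gamma>) 0)) \<le> (\<integral>\<^sup>+t\<in>{0..b}. ennreal (speed \<A> g \<gamma> t) \<partial>lborel)"
    proof (rule norm_displacement_le_nn_integral[where S = ?S and D = "\<lambda>t. l *\<^sub>R D t"])
      show "continuous_on {0..b} (\<lambda>t. l *\<^sub>R (?\<phi> \<circ> \<gamma>) t)"
        using cont\<eta> by (intro continuous_on_scaleR continuous_on_const)
      show "continuous_on ({0..b} - ?S) (\<lambda>t. l *\<^sub>R D t)"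
        using continuous_on_subset[OF D, of "{0..b} - ?S"] by (intro continuous_on_scaleR continuous_on_const) auto
      fix t assume t: "t \<in> {0..b} - ?S"
      then have dt: "((?\<phi> \<circ> \<gamma>) has_vector_derivative D t) (at t)" by (intro deriv) auto
      show "((\<lambda>t. l *\<^sub>R (?\<phi> \<circ> \<gamma>) t) has_vector_derivative l *\<^sub>R D t) (at t)"
        using bounded_linear.has_vector_derivative[OF bounded_linear_scaleR_right dt] .
      have "t \<in> interior {0..1}" using t b0 by auto
      then have "isCont \<gamma> t" using continuous_on_interior[OF cont] by simp
      have gt: "\<gamma> t \<in> K" using t by (intro inK) auto
      have "speed \<A> g \<gamma> t = sqrt (D t \<bullet> (g c (\<gamma> t) *v D t))"
        using c(1) K(1)[OF gt] \<open>isCont \<gamma> t\<close> dt by (rule speed_in_chart)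
      moreover have "l * norm (D t) \<le> sqrt (D t \<bullet> (g c (?\<psi> (?\<phi> (\<gamma> t))) *v D t))"
        by (rule l(2)[OF K(2)[OF gt]])
      ultimately show "norm (l *\<^sub>R D t) \<le> speed \<A> g \<gamma> t"
        using chart_inv_chart[OF c(1) K(1)[OF gt]] l(1) by simp
    qed (use S b0 in auto)
    also have "\<dots> \<le> curve_length \<A> g \<gamma>"
      unfolding curve_length_def using b0
      by (intro nn_integral_mono mult_left_mono) (auto simp: indicator_def)
    finally have len: "ennreal (norm (l *\<^sub>R (?\<phi> \<circ> \<gamma>) b - l *\<^sub>R (?\<phi> \<circ> \<gamma>) 0)) \<le> curve_length \<A> g \<gamma>" .
    have "\<gamma> b \<notin> W" "\<gamma> b \<in> fst c" using b(1) K(1)[OF inK] b0 by auto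
    then have "r \<le> dist (?\<phi> x) (?\<phi> (\<gamma> b))" by (auto simp: W_def not_less)
    then have "l * r \<le> norm (l *\<^sub>R ?\<phi> (\<gamma> b) - l *\<^sub>R ?\<phi> x)"
      using l(1) by (simp add: dist_norm norm_minus_commute scaleR_diff_right[symmetric] mult_left_mono)
    moreover have "\<gamma> 0 = x" using \<gamma>(2) by (simp add: pathstart_def)
    ultimately have "ennreal (l * r) \<le> ennreal (norm (l *\<^sub>R (?\<phi> \<circ> \<gamma>) b - l *\<^sub>R (?\<phi> \<circ> \<gamma>) 0))"
      by (simp add: ennreal_leI)
    then show ?thesis using len by (rule order_trans)
  qed
  \<comment> \<open>If no curve joins the two points, the infimum is infinite and the bound holds as
    well.\<close>
  then have "ennreal (l * r) \<le> riemannian_dist \<A> g x z" if "z \<notin> U" for z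
    using that unfolding riemannian_dist_def by (intro INF_greatest) auto
  then have "z \<in> U" if "riemannian_dist \<A> g x z < ennreal (l * r)" for z
    using that by (meson not_less)
  then show thesis using that[of "l * r"] l(1) r(1) by simp
qed

text \<open>The density is continuous on a closed coordinate ball, hence bounded there, and the ball
  has finite Lebesgue measure.\<close>

lemma riemannian_volume_locally_finite:
  assumes v: "riemannian_volume \<A> g v"
  shows "\<exists>W. open W \<and> x \<in> W \<and> emeasure v W < \<infinity>"
proof -
  obtain c where c: "c \<in> \<A>" "x \<in> fst c" using ex_chart by blast
  let ?\<phi> = "snd c" and ?\<psi> = "chart_inv c"
  have hom: "homeomorphism (fst c) (?\<phi> ` fst c) ?\<phi> ?\<psi>" by (rule chart_homeomorphism[OF c(1)])
  have op: "open (fst c)" "open (?\<phi> ` fst c)" using chart_open[OF c(1)] by auto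
  obtain r where r: "0 < r" "cball (?\<phi> x) r \<subseteq> ?\<phi> ` fst c"
    using op(2) c(2) by (meson imageI open_contains_cball)
  let ?B = "cball (?\<phi> x) r"
  have "continuous_on ?B (\<lambda>y. sqrt (det (g c (?\<psi> y))))"
  proof (intro continuous_on_real_sqrt)
    have "continuous_on ?B (\<lambda>y. g c (?\<psi> y))"
      using continuous_on_metric[OF c(1)] r(2) by (rule continuous_on_subset)
    then show "continuous_on ?B (\<lambda>y. det (g c (?\<psi> y)))"
      unfolding det_def
      by (intro continuous_on_sum continuous_on_mult continuous_on_prod continuous_on_const continuous_on_component)
  qed
  then have "compact ((\<lambda>y. sqrt (det (g c (?\<psi> y)))) ` ?B)"
    using compact_cball by (rule compact_continuous_image)
  then have "bdd_above ((\<lambda>y. sqrt (det (g c (?\<psi> y)))) ` ?B)"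
    by (intro bounded_imp_bdd_above compact_imp_bounded)
  then obtain C where C: "\<And>y. y \<in> ?B \<Longrightarrow> sqrt (det (g c (?\<psi> y))) \<le> C"
    unfolding bdd_above_def by (metis imageI)
  define W where "W = fst c \<inter> ?\<phi> -` ball (?\<phi> x) r"
  have W: "open W"
    unfolding W_def using homeomorphism_cont1[OF hom] op(1) open_ball by (rule continuous_open_preimage)
  have "emeasure v W = (\<integral>\<^sup>+y\<in>?\<phi> ` W. ennreal (sqrt (det (g c (?\<psi> y)))) \<partial>lborel)"
    using v c(1) W unfolding riemannian_volume_def by (auto simp: W_def)
  also have "\<dots> \<le> (\<integral>\<^sup>+y. ennreal C * indicator ?B y \<partial>lborel)"
  proof (rule nn_integral_mono)
    fix y :: "real ^ 'n"
    have "y \<in> ?\<phi> ` W \<Longrightarrow> y \<in> ?B" by (auto simp: W_def)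
    then show "ennreal (sqrt (det (g c (?\<psi> y)))) * indicator (?\<phi> ` W) y \<le> ennreal C * indicator ?B y"
      using C[of y] by (auto simp: indicator_def intro: ennreal_leI)
  qed
  also have "\<dots> = ennreal C * emeasure lborel ?B" by (simp add: nn_integral_cmult_indicator)
  also have "\<dots> < \<infinity>"
    using emeasure_lborel_cball_finite[of "?\<phi> x" r] by (simp add: ennreal_mult_less_top)
  finally have "emeasure v W < \<infinity>" .
  moreover have "x \<in> W" using c r by (simp add: W_def)
  ultimately show ?thesis using W by blast
qed

end


section \<open>The limit measure\<close>

lemma finite_riemannian_volume:
  fixes \<A> :: "('a::{t2_space,second_countable_topology}, 'n::finite) chart set"
  assumes M: "compact_riemannian_manifold \<A> g" and v: "riemannian_volume \<A> g v"
  shows "finite_measure v"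
proof (rule finite_measureI)
  have cpt: "compact (UNIV :: 'a set)" and geo: "smooth_atlas \<A>" "riemannian_metric \<A> g"
    using M by (auto simp: compact_riemannian_manifold_def)
  have sets_v: "sets v = sets borel" using v by (simp add: riemannian_volume_def)
  obtain W where W: "\<And>x. open (W x) \<and> x \<in> W x \<and> emeasure v (W x) < \<infinity>"
    using riemannian_volume_locally_finite[OF geo v] by metis
  obtain K where K: "finite K" "UNIV \<subseteq> (\<Union>x\<in>K. W x)"
    using compactE_image[OF cpt, of UNIV W] W by (metis UNIV_I UN_I subsetI)
  have "space v = UNIV" using sets_eq_imp_space_eq[OF sets_v] by simp
  then have "emeasure v (space v) \<le> emeasure v (\<Union>x\<in>K. W x)"
    using K W sets_v by (intro emeasure_mono) auto
  also have "\<dots> \<le> (\<Sum>x\<in>K. emeasure v (W x))"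
    using K W sets_v by (intro emeasure_subadditive_finite) auto
  also have "\<dots> < \<infinity>" using W by (simp add: K(1))
  finally show "emeasure v (space v) \<noteq> \<infinity>" by simp
qed

section \<open>Cell measures as densities, and averages over cells\<close>

lemma cell_measure_eq_density:
  assumes v: "sets v = sets borel" and I: "finite I" and M: "\<And>i. i \<in> I \<Longrightarrow> closed (M i)"
  shows "cell_measure v I M w =
    density v (\<lambda>x. \<Sum>i\<in>I. ennreal (w i) / emeasure v (M i) * indicator (M i) x)"
proof (rule measure_eqI)
  fix B assume "B \<in> sets (cell_measure v I M w)"
  then have B: "B \<in> sets borel" by simp
  have M': "M i \<in> sets v" if "i \<in> I" for i using M[OF that] v by simp
  have "emeasure (density v (\<lambda>x. \<Sum>i\<in>I. ennreal (w i) / emeasure v (M i) * indicator (M i) x)) B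
      = (\<integral>\<^sup>+x. (\<Sum>i\<in>I. ennreal (w i) / emeasure v (M i) * indicator (M i) x) * indicator B x \<partial>v)"
    using M' B v by (intro emeasure_density) auto
  also have "\<dots> = (\<integral>\<^sup>+x. (\<Sum>i\<in>I. ennreal (w i) / emeasure v (M i) * indicator (B \<inter> M i) x) \<partial>v)"
    by (intro nn_integral_cong) (auto simp: indicator_def sum_distrib_right intro!: sum.cong)
  also have "\<dots> = (\<Sum>i\<in>I. \<integral>\<^sup>+x. ennreal (w i) / emeasure v (M i) * indicator (B \<inter> M i) x \<partial>v)"
    using M' B v by (intro nn_integral_sum) auto
  also have "\<dots> = (\<Sum>i\<in>I. ennreal (w i) * (emeasure v (B \<inter> M i) / emeasure v (M i)))"
  proof (rule sum.cong[OF refl])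
    fix i assume "i \<in> I"
    then have "B \<inter> M i \<in> sets v" using M' B v by auto
    then show "(\<integral>\<^sup>+x. ennreal (w i) / emeasure v (M i) * indicator (B \<inter> M i) x \<partial>v)
        = ennreal (w i) * (emeasure v (B \<inter> M i) / emeasure v (M i))"
      by (subst nn_integral_cmult_indicator) (auto simp: divide_ennreal_def ac_simps)
  qed
  finally show "emeasure (cell_measure v I M w) B =
      emeasure (density v (\<lambda>x. \<Sum>i\<in>I. ennreal (w i) / emeasure v (M i) * indicator (M i) x)) B"
    using emeasure_cell_measure[OF v M B] by simp
qed (simp add: v)

lemma integral_cell_measure:
  fixes \<phi> :: "'a::topological_space \<Rightarrow> real"
  assumes v: "sets v = sets borel" and I: "finite I" and M: "\<And>i. i \<in> I \<Longrightarrow> closed (M i)"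
    and pos: "\<And>i. i \<in> I \<Longrightarrow> measure v (M i) \<noteq> 0" and w: "\<And>i. i \<in> I \<Longrightarrow> 0 \<le> w i"
    and \<phi>: "\<phi> \<in> borel_measurable borel"
    and int: "\<And>i. i \<in> I \<Longrightarrow> set_integrable v (M i) \<phi>"
  shows "(\<integral>x. \<phi> x \<partial>cell_measure v I M w) = (\<Sum>i\<in>I. w i * ((LINT x:M i|v. \<phi> x) / measure v (M i)))"
proof -
  have M': "M i \<in> sets v" if "i \<in> I" for i using M[OF that] v by simp
  let ?h = "\<lambda>x. \<Sum>i\<in>I. w i / measure v (M i) * indicator (M i) x"
  have "(\<Sum>i\<in>I. ennreal (w i) / emeasure v (M i) * indicator (M i) x) = ennreal (?h x)" for x
  proof -
    have "ennreal (w i) / emeasure v (M i) * indicator (M i) x = ennreal (w i / measure v (M i) * indicator (M i) x)"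
      if i: "i \<in> I" for i
    proof -
      \<comment> \<open>\<open>measure\<close> is 0 on sets of infinite measure, so a nonzero value
        also gives finiteness.\<close>
      have "emeasure v (M i) \<noteq> \<infinity>" using pos[OF i] by (auto simp: measure_def)
      then have "emeasure v (M i) = ennreal (measure v (M i))" by (simp add: emeasure_eq_ennreal_measure)
      moreover have "0 < measure v (M i)" using pos[OF i] by (simp add: zero_less_measure_iff)
      ultimately show ?thesis
        using w[OF i] by (simp add: divide_ennreal indicator_def)
    qed
    then have "(\<Sum>i\<in>I. ennreal (w i) / emeasure v (M i) * indicator (M i) x)
        = (\<Sum>i\<in>I. ennreal (w i / measure v (M i) * indicator (M i) x))"
      by (rule sum.cong[OF refl])
    also have "\<dots> = ennreal (?h x)"
      using w by (intro sum_ennreal) (simp add: indicator_def)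
    finally show ?thesis .
  qed
  then have "cell_measure v I M w = density v (\<lambda>x. ennreal (?h x))"
    using cell_measure_eq_density[OF v I M, where w = w] by (simp only:)
  moreover have "?h \<in> borel_measurable v"
    using M' by (intro borel_measurable_sum borel_measurable_times borel_measurable_const borel_measurable_indicator)
  moreover have "\<phi> \<in> borel_measurable v" using \<phi> v by (simp cong: measurable_cong_sets)
  ultimately have "(\<integral>x. \<phi> x \<partial>cell_measure v I M w) = (\<integral>x. ?h x *\<^sub>R \<phi> x \<partial>v)"
    using w by (simp only:) (intro integral_density, auto intro!: AE_I2 sum_nonneg simp: indicator_def)
  also have "\<dots> = (\<integral>x. (\<Sum>i\<in>I. w i / measure v (M i) * (indicator (M i) x *\<^sub>R \<phi> x)) \<partial>v)"
    by (simp add: sum_distrib_right mult.assoc)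
  also have "\<dots> = (\<Sum>i\<in>I. \<integral>x. w i / measure v (M i) * (indicator (M i) x *\<^sub>R \<phi> x) \<partial>v)"
    using int unfolding set_integrable_def
    by (intro Bochner_Integration.integral_sum integrable_mult_right)
  also have "\<dots> = (\<Sum>i\<in>I. w i * ((LINT x:M i|v. \<phi> x) / measure v (M i)))"
    unfolding integral_mult_right_zero set_lebesgue_integral_def[symmetric] by simp
  finally show ?thesis .
qed

text \<open>Integrate the bounds \<open>c - e\<close> and \<open>c + e\<close> over
  \<open>A\<close>. This is the property that \<open>averages_LIMSEQ\<close> asks of its
  averages.\<close>

lemma set_average_deviation:
  fixes \<phi> :: "'a \<Rightarrow> real"
  assumes "finite_measure v" "A \<in> sets v" "measure v A \<noteq> 0" and int: "set_integrable v A \<phi>"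
    and dev: "\<And>y. y \<in> A \<Longrightarrow> \<bar>\<phi> y - c\<bar> \<le> e"
  shows "\<bar>(LINT x:A|v. \<phi> x) / measure v A - c\<bar> \<le> e"
proof -
  interpret finite_measure v by fact
  have fin: "emeasure v A < \<infinity>" by (simp add: less_top[symmetric])
  have const: "set_integrable v A (\<lambda>_. b)" "(LINT x:A|v. b) = measure v A * b" for b :: real
    using assms(2) fin by (auto simp: set_integrable_def set_lebesgue_integral_def sets.Int_space_eq2)
  have pos: "0 < measure v A" using assms(3) by (simp add: zero_less_measure_iff)
  have "(LINT x:A|v. \<phi> x) \<le> (LINT x:A|v. c + e)" "(LINT x:A|v. c - e) \<le> (LINT x:A|v. \<phi> x)"
    using dev by (auto intro!: set_integral_mono int const(1) simp: abs_le_iff algebra_simps)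
  then have "(LINT x:A|v. \<phi> x) \<le> measure v A * (c + e)" "measure v A * (c - e) \<le> (LINT x:A|v. \<phi> x)"
    by (simp_all only: const(2))
  then have "(LINT x:A|v. \<phi> x) / measure v A \<le> c + e" "c - e \<le> (LINT x:A|v. \<phi> x) / measure v A"
    using pos by (simp_all add: pos_divide_le_eq pos_le_divide_eq mult.commute)
  then show ?thesis by (simp add: abs_le_iff)
qed

theorem theorem9:
  fixes \<A> :: "('a::{t2_space,second_countable_topology}, 'n::finite) chart set"
    and g :: "('a, 'n) chart \<Rightarrow> 'a \<Rightarrow> real ^ 'n ^ 'n"
    and v :: "'a measure"
    and f :: "'a \<Rightarrow> 'a"
    and I :: "nat \<Rightarrow> 'i set"
    and M :: "nat \<Rightarrow> 'i \<Rightarrow> 'a set"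
    and s :: "nat \<Rightarrow> 'i \<Rightarrow> 'i"
    and G :: "nat \<Rightarrow> ('i, 'i \<times> 'i) pre_digraph"
    and m :: "nat \<Rightarrow> 'i \<times> 'i \<Rightarrow> real"
    and \<mu>s :: "nat \<Rightarrow> 'a measure"
  assumes "compact_riemannian_manifold \<A> g"
    and "riemannian_volume \<A> g v"
    and "homeomorphism UNIV UNIV f (inv f)"
    and "\<And>k. polyhedral_covering TYPE('n) v (I k) (M k)"
    and "\<And>k. subdivision (I k) (M k) (I (Suc k)) (M (Suc k)) (s k)"
    and "(\<lambda>k. MAX i\<in>I k. riemannian_diameter \<A> g (M k i)) \<longlonglongrightarrow> 0"
    and "\<And>k. G k = symbolic_image f (I k) (M k)"
    and "\<And>k. simple_flow (G k) (m k)"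
    and "consistent_flows G s m"
    and "\<And>k. \<mu>s k = cell_measure v (I k) (M k) (vertex_measure (G k) (m k))"
  shows "\<exists>\<mu>. invariant_measure f \<mu> \<and> weakly_converges \<mu>s \<mu> \<and> ergodic_measure f \<mu>"
proof -
  have geo: "smooth_atlas \<A>" "riemannian_metric \<A> g" and cpt: "compact (UNIV :: 'a set)"
    using assms(1) by (auto simp: compact_riemannian_manifold_def)
  have finI: "finite (I k)" for k using assms(4)[of k] by (simp add: polyhedral_covering_def)
  have cells: "closed (M k i)" "emeasure v (M k i) \<noteq> 0" if "i \<in> I k" for k i
    using assms(4)[of k] that unfolding polyhedral_covering_def by blast+
  have "simple_flow (symbolic_image f (I k) (M k)) (m k)" for k
    using assms(8)[of k] unfolding assms(7) .
  moreover have "push_flow (symbolic_image f (I (Suc k)) (M (Suc k))) (s k) (m (Suc k)) = m k" for k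
    using assms(9) unfolding consistent_flows_def assms(7) by blast
  ultimately obtain p c where c: "\<And>k. cycle_enumeration f (I k) (M k) (m k) (p k) (c k)"
    and s: "\<And>k j. s k (c (Suc k) j) = c k j"
    using coherent_cycle_enumerations[of f I M m s] finI by blast
  have p: "0 < p k" and inj: "inj_on (c k) {..<p k}" and per: "c k (j + p k) = c k j"
    and cI: "c k j \<in> I k" and meets: "f ` M k (c k j) \<inter> M k (c k (Suc j)) \<noteq> {}" for k j
    using c[of k] unfolding cycle_enumeration_def by blast+
  let ?N = "\<lambda>k j. M k (c k j)"
  interpret cyclic_cells p f ?N
  proof
    fix k j
    show "0 < p k" by (rule p)
    \<comment> \<open>The coarse enumeration is the image of the finer one under \<open>s k\<close>
      and inherits its period; equal values occur only at congruent indices, so \<open>p k\<close>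
      divides it.\<close>
    have "c k (0 + p (Suc k)) = c k 0"
      using per[of "Suc k" 0] s by metis
    then have "(0 + p (Suc k)) mod p k = 0 mod p k"
      using periodic_eq_iff[of "c k", OF per inj p] by blast
    then show "p k dvd p (Suc k)" by (simp add: dvd_eq_mod_eq_0)
    show "compact (UNIV :: 'a set)" by (rule cpt)
    show "homeomorphism UNIV UNIV f (inv f)" by (rule assms(3))
    show "closed (?N k j)" by (rule cells(1)[OF cI])
    show "?N k (j + p k) = ?N k j" by (simp only: per)
    show "f ` ?N k j \<inter> ?N k (Suc j) \<noteq> {}" by (rule meets)
    have "M k (c k j) = (\<Union>l\<in>{l\<in>I (Suc k). s k l = c k j}. M (Suc k) l)"
      using assms(5)[of k] cI[of k j] unfolding subdivision_def by blast
    moreover have "c (Suc k) j \<in> {l\<in>I (Suc k). s k l = c k j}" using cI s by simp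
    ultimately show "?N (Suc k) j \<subseteq> ?N k j" by blast
  next
    fix U x assume "open U" "(x :: 'a) \<in> U"
    \<comment> \<open>Once all diameters are below the radius \<open>l\<close>, every cell
      containing \<open>x\<close> lies in \<open>U\<close>.\<close>
    then obtain l :: real where l: "0 < l" "\<And>z. riemannian_dist \<A> g x z < ennreal l \<Longrightarrow> z \<in> U"
      using riemannian_ball_subset_open[OF geo] by blast
    have "eventually (\<lambda>k. (MAX i\<in>I k. riemannian_diameter \<A> g (M k i)) < ennreal l) sequentially"
      using order_tendstoD(2)[OF assms(6), of "ennreal l"] l(1) by simp
    then obtain k0 where k0: "\<And>k. k0 \<le> k \<Longrightarrow> (MAX i\<in>I k. riemannian_diameter \<A> g (M k i)) < ennreal l"
      unfolding eventually_sequentially by blast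
    have "?N k j \<subseteq> U" if "k0 \<le> k" "x \<in> ?N k j" for k j
    proof
      fix z assume z: "z \<in> ?N k j"
      have "riemannian_dist \<A> g x z \<le> riemannian_diameter \<A> g (?N k j)"
        unfolding riemannian_diameter_def using that(2) z by (intro SUP_upper2[OF that(2)] SUP_upper)
      also have "\<dots> \<le> (MAX i\<in>I k. riemannian_diameter \<A> g (M k i))"
        using finI cI by (intro Max_ge) auto
      also have "\<dots> < ennreal l" by (rule k0[OF that(1)])
      finally show "z \<in> U" by (rule l(2))
    qed
    then show "\<exists>k0. \<forall>k\<ge>k0. \<forall>j. x \<in> ?N k j \<longrightarrow> ?N k j \<subseteq> U" by blast
  qed
  have sets_v: "sets v = sets borel" using assms(2) by (simp add: riemannian_volume_def)
  interpret v: finite_measure v by (rule finite_riemannian_volume[OF assms(1,2)])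
  have M_sets: "M k i \<in> sets v" and M_pos: "measure v (M k i) \<noteq> 0" if "i \<in> I k" for k i
    using cells[OF that] sets_v by (simp_all add: v.emeasure_eq_measure)
  have "weakly_converges \<mu>s cycle_measure"
    unfolding weakly_converges_def
  proof (intro allI impI)
    fix \<phi> :: "'a \<Rightarrow> real" assume \<phi>: "continuous_on UNIV \<phi>"
    have \<phi>_meas: "\<phi> \<in> borel_measurable borel" using \<phi> by (rule borel_measurable_continuous_onI)
    have "bounded (\<phi> ` UNIV)" using compact_continuous_image[OF \<phi> cpt] by (rule compact_imp_bounded)
    then obtain K where "\<And>x. \<bar>\<phi> x\<bar> \<le> K" by (auto simp: bounded_iff)
    then have "integrable v \<phi>"
      using \<phi>_meas sets_v by (intro v.integrable_const_bound[of _ K]) (auto cong: measurable_cong_sets)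
    then have int: "set_integrable v (M k i) \<phi>" if "i \<in> I k" for k i
      using M_sets[OF that] unfolding set_integrable_def by (rule integrable_mult_indicator[rotated])
    let ?a = "\<lambda>k i. (LINT x:M k i|v. \<phi> x) / measure v (M k i)"
    have "(\<integral>x. \<phi> x \<partial>\<mu>s k) = (\<Sum>j<p k. ?a k (c k j)) / real (p k)" for k
    proof -
      let ?w = "\<lambda>i. if i \<in> range (c k) then 1 / real (p k) else 0"
      have w: "vertex_measure (G k) (m k) = ?w"
        unfolding assms(7) by (rule ext) (rule vertex_measure_enumeration[OF c finI])
      have w_nonneg: "0 \<le> ?w i" for i by (cases "i \<in> range (c k)") simp_all
      have "(\<integral>x. \<phi> x \<partial>\<mu>s k) = (\<Sum>i\<in>I k. ?w i * ?a k i)"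
        unfolding assms(10) w
        using sets_v finI cells(1) M_pos w_nonneg \<phi>_meas int by (rule integral_cell_measure)
      \<comment> \<open>Cells off the cycle have weight 0; on the cycle the sum is a plain average
        over one period.\<close>
      also have "\<dots> = (\<Sum>i\<in>c k ` {..<p k}. ?w i * ?a k i)"
      proof (rule sum.mono_neutral_right[OF finI])
        have "c k j \<in> c k ` {..<p k}" for j
        proof (rule image_eqI)
          show "c k j = c k (j mod p k)" by (rule periodic_mod[of "c k", OF per, symmetric])
          show "j mod p k \<in> {..<p k}" using p by simp
        qed
        then show "\<forall>i\<in>I k - c k ` {..<p k}. ?w i * ?a k i = 0" by auto
      qed (use cI in blast)
      also have "\<dots> = (\<Sum>j<p k. ?w (c k j) * ?a k (c k j))"
        by (simp only: sum.reindex[OF inj] comp_def)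
      finally show ?thesis by (simp add: sum_divide_distrib mult.commute)
    qed
    moreover have "(\<lambda>k. (\<Sum>j<p k. ?a k (c k j)) / real (p k)) \<longlonglongrightarrow> (\<integral>x. \<phi> x \<partial>cycle_measure)"
      using \<phi>
    proof (rule averages_LIMSEQ)
      fix k j b e assume "\<And>y. y \<in> ?N k j \<Longrightarrow> \<bar>\<phi> y - b\<bar> \<le> e"
      then show "\<bar>?a k (c k j) - b\<bar> \<le> e"
        using v.finite_measure_axioms M_sets[OF cI] M_pos[OF cI] int[OF cI] by (intro set_average_deviation)
    qed
    ultimately show "(\<lambda>k. \<integral>x. \<phi> x \<partial>\<mu>s k) \<longlonglongrightarrow> (\<integral>x. \<phi> x \<partial>cycle_measure)" by (simp only:)
  qed
  then show ?thesis using invariant_cycle_measure ergodic_cycle_measure by blast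
qed

end
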